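(* Let $B=(B_t)_{t\ge 0}$ be hyperbolic Brownian motion on $\mathbb{H}^2$ started at the origin $o$, with radial process $R=(R_t)_{t\ge0}$ driven by the standard Brownian motion $W^R$, angle $\theta_t\in[0,2\pi)$ for $t>0$, and post-$s$ winding processes $\Theta^{(s)}=(\Theta^{(s)}_t)_{t\ge s}$, $s>0$ (all as defined in the context). Then, almost surely, $$\sup_{t\ge 0}\Bigl|R_t-W^R_t-\frac t2\Bigr|<\infty,\quad\text{and}\quad \lim_{t\to\infty}\frac{R_t}{t}=\lim_{t\to\infty}\frac{\mathbb{E}R_t}{t}=\frac12 .$$ Moreover, there exist a random variable $\theta_\infty$ with $\theta_\infty\sim\mathrm{Unif}[0,2\pi)$ and, for every $s>0$, a random variable $\Theta^{(s)}_\infty\in\mathbb{R}$, such that $$\lim_{t\to\infty}\theta_t=\theta_\infty \ \text{ a.s.},\quad\text{and, for every } s>0,\quad \lim_{t\to\infty}\Theta^{(s)}_t=\Theta^{(s)}_\infty\ \text{ a.s.}$$ Moreover, for every $s>0$, $$\limsup_{t\to\infty} t^{-1}\log\bigl|\Theta^{(s)}_\infty-\Theta^{(s)}_t\bigr|=\limsup_{t\to\infty}t^{-1}\log\bigl|\theta_\infty-\theta_t\bigr|=-\frac12\quad\text{a.s.}$$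
   Context: $\mathbb{H}^2$ is the hyperbolic plane: the complete, simply connected two-dimensional Riemannian manifold of constant curvature $-1$, with distance $d_{\mathbb{H}}$ and a distinguished origin $o$. A point $x\ne o$ is represented in geodesic polar coordinates $x=(r,\theta)$, where $r=d_{\mathbb{H}}(o,x)\in(0,\infty)$ and $\theta\in[0,2\pi)$ is the angle at $o$ relative to a fixed reference direction. Hyperbolic Brownian motion $B=(B_t)_{t\ge0}$ started from $B_0=o$ is described in geodesic polar coordinates by $B_t=(R_t,\theta_t)$, $t>0$, as follows. The continuous radial process $R=(R_t)_{t\ge0}$ takes values in $[0,\infty)$, has $R_0=0$, and satisfies $$\mathrm{d}R_t=\frac{\mathrm{d}t}{2\tanh R_t}+\mathrm{d}W^R_t,\qquad t\ge0,$$ where $W^R$ is a standard real Brownian motion; one has $R_t>0$ for all $t>0$ a.s. For every $s>0$, the post-$s$ winding process $\Theta^{(s)}=(\Theta^{(s)}_t)_{t\ge s}$ is real-valued, has $\Theta^{(s)}_s=0$, and satisfies $$\mathrm{d}\Theta^{(s)}_t=\frac{\mathrm{d}W^{(s)}_t}{\sinh R_t},\qquad t\ge s,$$ where $W^{(s)}$ is a standard Brownian motion independent of $W^R$. The angle satisfies $\theta_t=(\theta_s+\Theta^{(s)}_t)$ modulo $2\pi$ for all $t\ge s>0$, and $\theta_s\sim\mathrm{Unif}[0,2\pi)$ for every $s>0$. These properties determine the law of $B$ uniquely, and this law is rotationally invariant about $o$. *)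

theory Defs
  imports "HOL-Probability.Probability" "HOL-Library.Real_Mod"
begin

text \<open>
  The hyperbolic plane is the Poincare disc: the open unit disc \<open>ball 0 1\<close> of the complex plane with
  the metric \<open>4 |dz|\<^sup>2 / (1 - |z|\<^sup>2)\<^sup>2\<close>, which has constant curvature \<open>-1\<close>. The origin is \<open>0\<close> and
  the reference direction is the positive real axis. The metric is conformal, so the angle at the
  origin is the Euclidean argument; \<open>polar_angle 0\<close> is a junk value and is only reached at time 0.
\<close>

definition hyp_dist :: "complex \<Rightarrow> complex \<Rightarrow> real" where
  "hyp_dist z w = arcosh (1 + 2 * (cmod (z - w))\<^sup>2 / ((1 - (cmod z)\<^sup>2) * (1 - (cmod w)\<^sup>2)))"

definition polar_radius :: "complex \<Rightarrow> real" where
  "polar_radius z = hyp_dist 0 z"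

definition polar_angle :: "complex \<Rightarrow> real" where
  "polar_angle z = Arg2pi z"

text \<open>The logarithm on \<open>[0, \<infinity>)\<close> with \<open>log 0 = -\<infinity>\<close>, in contrast to \<open>ln 0 = 0\<close>.\<close>

definition eln :: "real \<Rightarrow> ereal" where
  "eln x = (if x > 0 then ereal (ln x) else -\<infinity>)"

context prob_space
begin

definition standard_brownian_motion :: "(real \<Rightarrow> 'a \<Rightarrow> real) \<Rightarrow> bool" where
  "standard_brownian_motion W \<longleftrightarrow>
     (\<forall>t\<ge>0. random_variable borel (W t)) \<and>
     (AE \<omega> in M. W 0 \<omega> = 0) \<and>
     (\<forall>s t. 0 \<le> s \<and> s < t \<longrightarrow>
        distributed M lborel (\<lambda>\<omega>. W t \<omega> - W s \<omega>) (normal_density 0 (sqrt (t - s)))) \<and>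
     (\<forall>(n::nat) \<tau>. 0 \<le> \<tau> 0 \<and> (\<forall>i<n. \<tau> i \<le> \<tau> (Suc i)) \<longrightarrow>
        indep_vars (\<lambda>_. borel) (\<lambda>i \<omega>. W (\<tau> (Suc i)) \<omega> - W (\<tau> i) \<omega>) {..<n}) \<and>
     (AE \<omega> in M. continuous_on {0..} (\<lambda>t. W t \<omega>))"

definition indep_processes :: "(real \<Rightarrow> 'a \<Rightarrow> real) \<Rightarrow> (real \<Rightarrow> 'a \<Rightarrow> real) \<Rightarrow> bool" where
  "indep_processes X Y \<longleftrightarrow>
     indep_var (\<Pi>\<^sub>M t\<in>{0..}. borel) (\<lambda>\<omega>. \<lambda>t\<in>{0..}. X t \<omega>)
               (\<Pi>\<^sub>M t\<in>{0..}. borel) (\<lambda>\<omega>. \<lambda>t\<in>{0..}. Y t \<omega>)"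

text \<open>
  \<open>ito_integral_from s H W I\<close>: the process \<open>I\<close> on \<open>[s, \<infinity>)\<close> is the Ito integral
  \<open>I\<^sub>t = \<integral>\<^sub>s\<^sup>t H\<^sub>u dW\<^sub>u\<close>, for an integrand \<open>H\<close> with continuous paths on \<open>[s, \<infinity>)\<close>. For continuous
  (adapted) integrands the Ito integral is the continuous process whose value at \<open>t\<close> is the limit in
  probability, as the mesh tends to zero, of the left-endpoint Riemann sums over partitions of
  \<open>[s, t]\<close>; this determines \<open>I\<close> up to indistinguishability.
\<close>

definition ito_integral_from ::
    "real \<Rightarrow> (real \<Rightarrow> 'a \<Rightarrow> real) \<Rightarrow> (real \<Rightarrow> 'a \<Rightarrow> real) \<Rightarrow> (real \<Rightarrow> 'a \<Rightarrow> real) \<Rightarrow> bool" where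
  "ito_integral_from s H W I \<longleftrightarrow>
     (\<forall>t\<ge>s. random_variable borel (I t)) \<and>
     (AE \<omega> in M. I s \<omega> = 0) \<and>
     (AE \<omega> in M. continuous_on {s..} (\<lambda>t. I t \<omega>)) \<and>
     (\<forall>t\<ge>s. \<forall>\<epsilon>>0. \<exists>\<delta>>0. \<forall>(n::nat) \<tau>.
        \<tau> 0 = s \<and> \<tau> n = t \<and> (\<forall>i<n. \<tau> i \<le> \<tau> (Suc i) \<and> \<tau> (Suc i) - \<tau> i < \<delta>) \<longrightarrow>
        prob {\<omega> \<in> space M.
          \<bar>(\<Sum>i<n. H (\<tau> i) \<omega> * (W (\<tau> (Suc i)) \<omega> - W (\<tau> i) \<omega>)) - I t \<omega>\<bar> > \<epsilon>} < \<epsilon>)"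

definition uniform_angle :: "('a \<Rightarrow> real) \<Rightarrow> bool" where
  "uniform_angle X \<longleftrightarrow>
     random_variable borel X \<and> distr M borel X = uniform_measure lborel {0..<2 * pi}"

end

text \<open>
  Hyperbolic Brownian motion \<open>B\<close> started from the origin. \<open>WR\<close> is the Brownian motion driving the
  radial process; for every \<open>s > 0\<close>, \<open>\<Theta> s\<close> is the post-\<open>s\<close> winding process and \<open>W s\<close> its driving
  Brownian motion. Only the increments of \<open>W s\<close> after time \<open>s\<close> matter, so \<open>W s\<close> may equally well be a
  Brownian motion on \<open>[0, \<infinity>)\<close> or one started from \<open>0\<close> at time \<open>s\<close>. The null sets in \<open>winding_sde\<close>
  and \<open>angle_winding\<close> may depend on \<open>s\<close>.
\<close>

locale hyperbolic_brownian_motion = prob_space M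
  for M :: "'a measure"
    and B :: "real \<Rightarrow> 'a \<Rightarrow> complex"
    and WR :: "real \<Rightarrow> 'a \<Rightarrow> real"
    and W :: "real \<Rightarrow> real \<Rightarrow> 'a \<Rightarrow> real"
    and \<Theta> :: "real \<Rightarrow> real \<Rightarrow> 'a \<Rightarrow> real" +
  assumes B_measurable: "\<And>t. t \<ge> 0 \<Longrightarrow> random_variable borel (B t)"
    and B_in_disc: "\<And>t \<omega>. t \<ge> 0 \<Longrightarrow> \<omega> \<in> space M \<Longrightarrow> B t \<omega> \<in> ball 0 1"
    and B_start: "AE \<omega> in M. B 0 \<omega> = 0"
    and WR_bm: "standard_brownian_motion WR"
    and radius_continuous: "AE \<omega> in M. continuous_on {0..} (\<lambda>t. polar_radius (B t \<omega>))"
    and radius_pos: "AE \<omega> in M. \<forall>t>0. polar_radius (B t \<omega>) > 0"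
    and radius_sde: "AE \<omega> in M. \<forall>t\<ge>0.
          set_integrable lborel {0..t} (\<lambda>u. 1 / (2 * tanh (polar_radius (B u \<omega>)))) \<and>
          polar_radius (B t \<omega>) =
            (LINT u:{0..t}|lborel. 1 / (2 * tanh (polar_radius (B u \<omega>)))) + WR t \<omega>"
    and W_bm: "\<And>s. s > 0 \<Longrightarrow> standard_brownian_motion (\<lambda>u \<omega>. W s (s + u) \<omega> - W s s \<omega>)"
    and W_indep: "\<And>s. s > 0 \<Longrightarrow> indep_processes (\<lambda>u \<omega>. W s (s + u) \<omega> - W s s \<omega>) WR"
    and winding_sde: "\<And>s. s > 0 \<Longrightarrow>
          ito_integral_from s (\<lambda>u \<omega>. 1 / sinh (polar_radius (B u \<omega>))) (W s) (\<Theta> s)"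
    and angle_winding: "\<And>s. s > 0 \<Longrightarrow> AE \<omega> in M. \<forall>t\<ge>s.
          polar_angle (B t \<omega>) = (polar_angle (B s \<omega>) + \<Theta> s t \<omega>) rmod (2 * pi)"
    and angle_uniform: "\<And>s. s > 0 \<Longrightarrow> uniform_angle (\<lambda>\<omega>. polar_angle (B s \<omega>))"

end

theory Submission
  imports Defs
begin

text \<open>
  The drift \<open>coth R / 2\<close> of the radial process is at least \<open>1/2\<close>, so \<open>R\<^sub>t \<ge> W\<^sub>t + t/2\<close>. Since a Brownian
  motion is \<open>o(t)\<close>, the radius grows at least linearly, hence \<open>coth R\<^sub>t - 1\<close> decays exponentially and
  is integrable along almost every path. This bounds \<open>R\<^sub>t - W\<^sub>t - t/2\<close> and gives \<open>R\<^sub>t / t \<longlongrightarrow> 1/2\<close>. For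
  the mean, the lower bound is \<open>E W\<^sub>t = 0\<close>. The upper bound compares \<open>R\<close> after its last visit below a
  level \<open>K\<close> with the drift \<open>coth K / 2\<close>; the error is twice the maximum of \<open>\<bar>W\<bar>\<close> on \<open>[0, t]\<close>, whose mean
  is of order \<open>sqrt t\<close>.

  The winding is a stochastic integral of \<open>1 / sinh R\<^sub>u \<approx> e\<^bsup>-u/2\<^esup>\<close> against a Brownian motion that is
  independent of \<open>R\<close>. Conditionally on \<open>R\<close>, its increment over \<open>[n, n + 1]\<close> is therefore a centred normal
  variable with standard deviation \<open>e\<^bsup>-n/2 + o(n)\<^esup>\<close>. Fourth moments and chaining bound its oscillation
  over \<open>[n, n + 1]\<close> by \<open>e\<^bsup>-cn\<^esup>\<close> for every \<open>c < 1/2\<close>, which yields convergence and the upper bound for the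
  rate. The small ball estimate \<open>P(\<bar>Z\<bar> \<le> y) \<le> y / \<sigma>\<close> shows that the increment exceeds \<open>e\<^bsup>-cn\<^esup>\<close> for
  every \<open>c > 1/2\<close> and all large \<open>n\<close>, which forces the lower bound. Borel and Cantelli turn both tail
  bounds into almost sure statements.

  The conditioning is done on Riemann sums. It requires that the radius be a function of its driving
  Brownian path: the decreasing drift makes the implicit Euler scheme a contraction, so \<open>R\<^sub>t\<close> is a limit
  of Borel functions of that path (\<open>radial_functional_eq\<close>). On the event where the integrand lies
  between two deterministic exponentials, clamping the integrand to these bounds does not change the
  Riemann sum. With the clamped integrand, freezing the radial path leaves a normal variable whose
  variance is controlled from both sides (\<open>winding_increment_tails\<close>).

  The angle at time \<open>t\<close> is the reduction modulo \<open>2\<pi>\<close> of \<open>\<theta>\<^sub>s + \<Theta>\<^sub>t\<close>. Since \<open>\<theta>\<^sub>t\<close> is uniform for every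
  \<open>t\<close>, the limit of \<open>\<theta>\<^sub>s + \<Theta>\<^sub>t\<close> almost surely avoids the multiples of \<open>2\<pi>\<close>, where the reduction jumps.
  Away from them the reduction is locally a translation, so the angle converges at the same rate as the
  winding, and its limit is again uniform.
\<close>

section \<open>Chaining over dyadic points\<close>

lemma dyadic_chain:
  fixes f :: "nat \<Rightarrow> nat \<Rightarrow> real" and c :: "nat \<Rightarrow> real"
  assumes refine: "\<And>m k. f (Suc m) (2 * k) = f m k"
    and step: "\<And>m k. k < 2 ^ m \<Longrightarrow> \<bar>f m (Suc k) - f m k\<bar> \<le> c m"
  shows "k \<le> 2 ^ m \<Longrightarrow> \<bar>f m k - f 0 0\<bar> \<le> (\<Sum>j\<le>m. c j)"
proof (induction m arbitrary: k)
  case 0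
  then have "k = 0 \<or> k = Suc 0" by auto
  with step[of 0 0] show ?case by (auto simp: abs_le_iff)
next
  case (Suc m)
  have c0: "0 \<le> c (Suc m)" using step[of 0 "Suc m"] by auto
  show ?case
  proof (cases "even k")
    case True
    then obtain i where k: "k = 2 * i" by blast
    with Suc.prems have "i \<le> 2 ^ m" by simp
    from Suc.IH[OF this] c0 show ?thesis by (simp add: k refine)
  next
    case False
    then obtain i where k: "k = Suc (2 * i)" by (metis oddE Suc_eq_plus1)
    with Suc.prems have i: "2 * i < 2 ^ Suc m" by simp
    then have "i \<le> 2 ^ m" by simp
    from Suc.IH[OF this] step[OF i] show ?thesis by (simp add: k refine)
  qed
qed

text \<open>
  Kolmogorov's chaining argument. A process whose increments have the tails of a process with
  \<open>E (X\<^sub>t - X\<^sub>s)\<^sup>4 \<le> C (t - s)\<^sup>2\<close> has a maximum with the same tail up to a constant: a dyadic point is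
  reached from \<open>a\<close> through one increment per level, and there are only \<open>2\<^sup>m\<close> increments at level \<open>m\<close>,
  each of which exceeds a fixed size with probability of order \<open>4\<^bsup>-m\<^esup>\<close>. The event \<open>A\<close> localizes
  the hypothesis: the increments are controlled only there.
\<close>

lemma (in prob_space) chaining_tail_bound:
  fixes X :: "real \<Rightarrow> 'a \<Rightarrow> real" and p :: "nat \<Rightarrow> nat \<Rightarrow> real"
  assumes p: "\<And>m k. p m k = a + (b - a) * real k / 2 ^ m"
    and A: "A \<in> events"
    and meas: "\<And>m k. k \<le> 2 ^ m \<Longrightarrow> random_variable borel (X (p m k))"
    and tail: "\<And>m k x. k < 2 ^ m \<Longrightarrow> 0 < x \<Longrightarrow>
        prob {\<omega> \<in> A. x < \<bar>X (p m (Suc k)) \<omega> - X (p m k) \<omega>\<bar>} \<le> C / (4 ^ m * x ^ 4)"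
    and x: "0 < x"
  shows "{\<omega> \<in> A. \<exists>m. \<exists>k\<le>2 ^ m. x < \<bar>X (p m k) \<omega> - X a \<omega>\<bar>} \<in> events"
    and "prob {\<omega> \<in> A. \<exists>m. \<exists>k\<le>2 ^ m. x < \<bar>X (p m k) \<omega> - X a \<omega>\<bar>} \<le> 50000 * C / x ^ 4"
proof -
  \<comment> \<open>The thresholds sum to \<open>x\<close>. A ratio \<open>q\<close> with \<open>2 q\<^sup>4 > 1\<close> keeps the union bound over all levels
  summable, and \<open>q = 9/10\<close> gives the ratio \<open>5000/6561\<close> there.\<close>
  define c :: "nat \<Rightarrow> real" where "c = (\<lambda>m. x / 10 * (9 / 10) ^ m)"
  define E where "E = (\<lambda>m k. {\<omega> \<in> A. c m < \<bar>X (p m (Suc k)) \<omega> - X (p m k) \<omega>\<bar>})"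
  define U where "U = (\<lambda>m. \<Union>k\<in>{..<2 ^ m}. E m k)"
  have cpos: "c m > 0" for m using x by (simp add: c_def)
  have Xa: "random_variable borel (X a)" using meas[of 0 0] by (simp add: p)
  have AS: "A \<subseteq> space M" using A by (rule sets.sets_into_space)
  have eqS: "{\<omega> \<in> A. P \<omega>} = A \<inter> {\<omega> \<in> space M. P \<omega>}" for P using AS by auto
  have Emeas: "E m k \<in> events" if "k < 2 ^ m" for m k
  proof -
    have [measurable]: "random_variable borel (X (p m k))" "random_variable borel (X (p m (Suc k)))"
      using that by (auto intro!: meas)
    show ?thesis unfolding E_def eqS using A by measurable
  qed
  have Umeas: "U m \<in> events" for m unfolding U_def using Emeas by auto
  show Bmeas: "{\<omega> \<in> A. \<exists>m. \<exists>k\<le>2 ^ m. x < \<bar>X (p m k) \<omega> - X a \<omega>\<bar>} \<in> events"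
  proof -
    have "{\<omega> \<in> A. \<exists>m. \<exists>k\<le>2 ^ m. x < \<bar>X (p m k) \<omega> - X a \<omega>\<bar>} =
      (\<Union>m. \<Union>k\<in>{..2 ^ m}. {\<omega> \<in> A. x < \<bar>X (p m k) \<omega> - X a \<omega>\<bar>})" by auto
    moreover have "{\<omega> \<in> A. x < \<bar>X (p m k) \<omega> - X a \<omega>\<bar>} \<in> events" if "k \<le> 2 ^ m" for m k
    proof -
      note [measurable] = meas[OF that] Xa A
      show ?thesis unfolding eqS by measurable
    qed
    ultimately show ?thesis by auto
  qed
  have C0: "0 \<le> C" using tail[of 0 0 1] by (auto intro: order_trans[OF measure_nonneg])
  define q :: "nat \<Rightarrow> real" where "q = (\<lambda>m. 10000 * C / x ^ 4 * (5000 / 6561) ^ m)"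
  have PU: "prob (U m) \<le> q m" for m
  proof -
    have "prob (U m) \<le> (\<Sum>k\<in>{..<2 ^ m}. prob (E m k))"
      unfolding U_def by (rule finite_measure_subadditive_finite) (use Emeas in auto)
    also have "\<dots> \<le> (\<Sum>k\<in>{..<(2::nat) ^ m}. C / (4 ^ m * c m ^ 4))"
      unfolding E_def by (rule sum_mono) (use tail cpos in auto)
    also have "\<dots> = 2 ^ m * C / (4 ^ m * c m ^ 4)" by simp
    also have "\<dots> = q m"
    proof -
      have "c m ^ 4 = x ^ 4 / 10000 * (6561 / 10000) ^ m"
        by (simp add: c_def power_mult_distrib power_divide flip: power_mult)
           (simp add: power_mult mult.commute[of m])
      moreover have "(4::real) ^ m = 2 ^ m * 2 ^ m" by (simp flip: power_mult_distrib)
      moreover have "(10000::real) ^ m = 2 ^ m * 5000 ^ m" by (simp flip: power_mult_distrib)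
      ultimately have c4: "c m ^ 4 = x ^ 4 * 6561 ^ m / (10000 * (2 ^ m * 5000 ^ m))" and "(4::real) ^ m = 2 ^ m * 2 ^ m"
        by (simp_all add: power_divide)
      then show ?thesis by (simp add: q_def power_divide)
    qed
    finally show ?thesis .
  qed
  have qsum: "q sums (10000 * C / x ^ 4 * (1 / (1 - 5000 / 6561)))"
    unfolding q_def by (intro sums_mult geometric_sums) simp
  then have qs: "summable q" and qv: "suminf q = 10000 * C / x ^ 4 * (1 / (1 - 5000 / 6561))"
    by (auto simp: sums_iff)
  have sU: "summable (\<lambda>m. prob (U m))"
    by (rule summable_comparison_test'[OF qs]) (use PU in auto)
  have "prob {\<omega> \<in> A. \<exists>m. \<exists>k\<le>2 ^ m. x < \<bar>X (p m k) \<omega> - X a \<omega>\<bar>} \<le> prob (\<Union>m. U m)"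
  proof (rule finite_measure_mono)
    show "(\<Union>m. U m) \<in> events" using Umeas by auto
    show "{\<omega> \<in> A. \<exists>m. \<exists>k\<le>2 ^ m. x < \<bar>X (p m k) \<omega> - X a \<omega>\<bar>} \<subseteq> (\<Union>m. U m)"
    proof (rule subsetI, rule ccontr)
      fix \<omega> assume w: "\<omega> \<in> {\<omega> \<in> A. \<exists>m. \<exists>k\<le>2 ^ m. x < \<bar>X (p m k) \<omega> - X a \<omega>\<bar>}" and n: "\<omega> \<notin> (\<Union>m. U m)"
      then obtain m k where mk: "k \<le> 2 ^ m" "x < \<bar>X (p m k) \<omega> - X a \<omega>\<bar>" and wA: "\<omega> \<in> A" by auto
      have "\<bar>X (p m k) \<omega> - X (p 0 0) \<omega>\<bar> \<le> (\<Sum>j\<le>m. c j)"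
      proof (rule dyadic_chain[where f = "\<lambda>m k. X (p m k) \<omega>"])
        show "X (p (Suc m) (2 * k)) \<omega> = X (p m k) \<omega>" for m k by (simp add: p)
        show "\<bar>X (p m (Suc k)) \<omega> - X (p m k) \<omega>\<bar> \<le> c m" if "k < 2 ^ m" for m k
          using n wA that by (auto simp: U_def E_def not_less)
      qed (use mk in auto)
      also have "(\<Sum>j\<le>m. c j) \<le> suminf c"
        unfolding c_def using x by (intro sum_le_suminf summable_mult) auto
      also have "suminf c = x" unfolding c_def by (subst suminf_mult) (auto simp: suminf_geometric)
      finally show False using mk by (simp add: p)
    qed
  qed
  also have "\<dots> \<le> (\<Sum>m. prob (U m))"
    by (rule finite_measure_subadditive_countably) (use Umeas sU in auto)
  also have "\<dots> \<le> suminf q" by (rule suminf_le[OF PU sU qs])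
  also have "\<dots> \<le> 50000 * C / x ^ 4"
    unfolding qv using C0 x by (simp add: field_simps)
  finally show "prob {\<omega> \<in> A. \<exists>m. \<exists>k\<le>2 ^ m. x < \<bar>X (p m k) \<omega> - X a \<omega>\<bar>} \<le> 50000 * C / x ^ 4" .
qed

lemma le_of_dyadic_le:
  fixes f :: "real \<Rightarrow> real"
  assumes cont: "continuous_on {a..b} f"
    and le: "\<And>m k. k \<le> 2 ^ m \<Longrightarrow> \<bar>f (a + (b - a) * real k / 2 ^ m) - f a\<bar> \<le> x"
    and t: "t \<in> {a..b}"
  shows "\<bar>f t - f a\<bar> \<le> x"
proof (cases "a = b")
  case True
  then show ?thesis using t le[of 0 0] by simp
next
  case False
  with t have ab: "a < b" by auto
  define r where "r = (t - a) / (b - a)"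
  have r: "0 \<le> r" "r \<le> 1" and tr: "t = a + (b - a) * r" using t ab by (auto simp: r_def divide_simps)
  define k where "k = (\<lambda>m. nat \<lfloor>r * 2 ^ m\<rfloor>)"
  have k: "real (k m) \<le> r * 2 ^ m" "r * 2 ^ m < real (k m) + 1" for m
    using r unfolding k_def by auto
  have k2: "k m \<le> 2 ^ m" for m
  proof -
    have "r * 2 ^ m \<le> 1 * 2 ^ m" by (rule mult_right_mono) (use r in auto)
    with k(1)[of m] have "real (k m) \<le> 2 ^ m" by linarith
    then show ?thesis by (metis of_nat_le_iff of_nat_numeral of_nat_power)
  qed
  have lim: "(\<lambda>m. real (k m) / 2 ^ m) \<longlonglongrightarrow> r"
  proof (rule real_tendsto_sandwich)
    show "\<forall>\<^sub>F m in sequentially. r - (1 / 2) ^ m \<le> real (k m) / 2 ^ m"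
      proof (intro always_eventually allI)
      fix m
      have "r \<le> (real (k m) + 1) / 2 ^ m" using k(2)[of m] by (simp add: field_simps)
      then show "r - (1 / 2) ^ m \<le> real (k m) / 2 ^ m" by (simp add: power_divide add_divide_distrib)
    qed
    show "\<forall>\<^sub>F m in sequentially. real (k m) / 2 ^ m \<le> r"
      using k(1) by (intro always_eventually allI) (simp add: field_simps)
    have "(\<lambda>m. r - (1 / 2) ^ m) \<longlonglongrightarrow> r - 0"
      by (intro tendsto_intros LIMSEQ_power_zero) simp
    then show "(\<lambda>m. r - (1 / 2) ^ m) \<longlonglongrightarrow> r" by simp
  qed simp
  have lim2: "(\<lambda>m. a + (b - a) * real (k m) / 2 ^ m) \<longlonglongrightarrow> t"
    unfolding tr times_divide_eq_right[symmetric] by (intro tendsto_intros lim)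
  have inab: "a + (b - a) * real (k m) / 2 ^ m \<in> {a..b}" for m
  proof -
    have "real (k m) / 2 ^ m \<le> 1" using k2[of m] by (simp add: divide_le_eq)
    then have "(b - a) * (real (k m) / 2 ^ m) \<le> (b - a) * 1" using ab by (intro mult_left_mono) auto
    then show ?thesis using ab by simp
  qed
  have "(\<lambda>m. f (a + (b - a) * real (k m) / 2 ^ m)) \<longlonglongrightarrow> f t"
    by (rule continuous_on_tendsto_compose[OF cont lim2 t]) (use inab in auto)
  then have "(\<lambda>m. \<bar>f (a + (b - a) * real (k m) / 2 ^ m) - f a\<bar>) \<longlonglongrightarrow> \<bar>f t - f a\<bar>"
    by (intro tendsto_intros)
  then show ?thesis by (rule LIMSEQ_le_const2) (use le k2 in auto)
qed

section \<open>Growth of Brownian motion\<close>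

context prob_space begin

lemma normal_tail_fourth_moment:
  assumes Z: "distributed M lborel Z (normal_density 0 \<sigma>)" and \<sigma>: "0 < \<sigma>" and x: "0 < x"
  shows "prob {\<omega> \<in> space M. x < \<bar>Z \<omega>\<bar>} \<le> 3 * \<sigma> ^ 4 / x ^ 4"
proof -
  have "emeasure M {\<omega> \<in> space M. x < \<bar>Z \<omega>\<bar>} = emeasure M (Z -` {z. x < \<bar>z\<bar>} \<inter> space M)"
    by (rule arg_cong[where f = "emeasure M"]) auto
  also have "\<dots> = (\<integral>\<^sup>+z. ennreal (normal_density 0 \<sigma> z) * indicator {z. x < \<bar>z\<bar>} z \<partial>lborel)"
    by (rule distributed_emeasure[OF Z]) simp
  also have "\<dots> \<le> (\<integral>\<^sup>+z. ennreal (normal_density 0 \<sigma> z * (z - 0) ^ (2 * 2) * (1 / x ^ 4)) \<partial>lborel)"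
  proof (rule nn_integral_mono)
    fix z :: real
    show "ennreal (normal_density 0 \<sigma> z) * indicator {z. x < \<bar>z\<bar>} z
        \<le> ennreal (normal_density 0 \<sigma> z * (z - 0) ^ (2 * 2) * (1 / x ^ 4))"
    proof (cases "x < \<bar>z\<bar>")
      case True
      then have "x ^ 4 \<le> \<bar>z\<bar> ^ 4" using x by (intro power_mono) auto
      then have "1 \<le> z ^ 4 / x ^ 4" using x by simp
      from mult_left_mono[OF this normal_density_nonneg[of 0 \<sigma> z]]
      show ?thesis using True by (auto intro!: ennreal_leI simp: mult.assoc)
    qed simp
  qed
  also have "\<dots> = ennreal ((fact (2 * 2) / ((2 / \<sigma>\<^sup>2) ^ 2 * fact 2)) * (1 / x ^ 4))"
  proof -
    have B: "has_bochner_integral lborel (\<lambda>z. normal_density 0 \<sigma> z * (z - 0) ^ (2 * 2) * (1 / x ^ 4))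
        ((fact (2 * 2) / ((2 / \<sigma>\<^sup>2) ^ 2 * fact 2)) * (1 / x ^ 4))"
      by (rule has_bochner_integral_mult_left[OF normal_moment_even[OF \<sigma>]])
    show ?thesis
      unfolding has_bochner_integral_integral_eq[OF B, symmetric]
      by (rule nn_integral_eq_integral) (use B x in \<open>auto simp: has_bochner_integral_iff\<close>)
  qed
  also have "(fact (2 * 2) / ((2 / \<sigma>\<^sup>2) ^ 2 * fact 2)) * (1 / x ^ 4) = 3 * \<sigma> ^ 4 / x ^ 4"
    using \<sigma> by (simp add: fact_numeral power_divide field_simps flip: power_mult)
  finally show ?thesis
    using \<sigma> x by (simp add: emeasure_eq_measure)
qed

lemma normal_small_ball:
  assumes Z: "distributed M lborel Z (normal_density 0 \<sigma>)" and \<sigma>: "0 < \<sigma>" and y: "0 \<le> y"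
  shows "prob {\<omega> \<in> space M. \<bar>Z \<omega>\<bar> \<le> y} \<le> y / \<sigma>"
proof -
  have "emeasure M {\<omega> \<in> space M. \<bar>Z \<omega>\<bar> \<le> y} = emeasure M (Z -` {-y..y} \<inter> space M)"
    by (rule arg_cong[where f = "emeasure M"]) auto
  also have "\<dots> = (\<integral>\<^sup>+z. ennreal (normal_density 0 \<sigma> z) * indicator {-y..y} z \<partial>lborel)"
    by (rule distributed_emeasure[OF Z]) simp
  also have "\<dots> \<le> (\<integral>\<^sup>+z. ennreal (1 / (2 * \<sigma>)) * indicator {-y..y} z \<partial>lborel)"
  proof (intro nn_integral_mono mult_right_mono ennreal_leI)
    fix z
    have "2 \<le> sqrt (2 * pi)" using pi_gt3 by (intro real_le_rsqrt) simp
    then have "2 * \<sigma> \<le> sqrt (2 * pi * \<sigma>\<^sup>2)"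
      using \<sigma> by (simp add: real_sqrt_mult)
    then have "1 / sqrt (2 * pi * \<sigma>\<^sup>2) \<le> 1 / (2 * \<sigma>)" using \<sigma> by (intro divide_left_mono mult_pos_pos) auto
    moreover have "exp (- (z - 0)\<^sup>2 / (2 * \<sigma>\<^sup>2)) \<le> 1" by simp
    ultimately show "normal_density 0 \<sigma> z \<le> 1 / (2 * \<sigma>)"
      unfolding normal_density_def using mult_mono[of "1 / sqrt (2 * pi * \<sigma>\<^sup>2)" "1 / (2 * \<sigma>)"] \<sigma> by force
  qed simp
  also have "\<dots> = ennreal (1 / (2 * \<sigma>)) * ennreal (2 * y)"
    using y by (simp add: nn_integral_cmult_indicator)
  also have "\<dots> = ennreal (y / \<sigma>)" using y \<sigma> by (subst ennreal_mult[symmetric]) auto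
  finally show ?thesis using y \<sigma> by (simp add: emeasure_eq_measure)
qed

lemma bm_measurable: "standard_brownian_motion W \<Longrightarrow> 0 \<le> t \<Longrightarrow> random_variable borel (W t)"
  by (simp add: standard_brownian_motion_def)

lemma bm_increment:
  "standard_brownian_motion W \<Longrightarrow> 0 \<le> s \<Longrightarrow> s < t \<Longrightarrow>
    distributed M lborel (\<lambda>\<omega>. W t \<omega> - W s \<omega>) (normal_density 0 (sqrt (t - s)))"
  by (simp add: standard_brownian_motion_def)

lemma bm_sup_tail:
  assumes W: "standard_brownian_motion W" and T: "0 < T" and x: "0 < x"
  shows "{\<omega> \<in> space M. \<exists>m. \<exists>k\<le>2 ^ m. x < \<bar>W (T * real k / 2 ^ m) \<omega> - W 0 \<omega>\<bar>} \<in> events"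
    and "prob {\<omega> \<in> space M. \<exists>m. \<exists>k\<le>2 ^ m. x < \<bar>W (T * real k / 2 ^ m) \<omega> - W 0 \<omega>\<bar>}
      \<le> 150000 * T\<^sup>2 / x ^ 4"
proof -
  define p :: "nat \<Rightarrow> nat \<Rightarrow> real" where "p = (\<lambda>m k. T * real k / 2 ^ m)"
  have pe: "p m k = 0 + (T - 0) * real k / 2 ^ m" for m k by (simp add: p_def)
  have meas: "random_variable borel (W (p m k))" if "k \<le> 2 ^ m" for m k
    using T by (intro bm_measurable[OF W]) (simp add: p_def)
  have tail: "prob {\<omega> \<in> space M. x < \<bar>W (p m (Suc k)) \<omega> - W (p m k) \<omega>\<bar>} \<le> 3 * T\<^sup>2 / (4 ^ m * x ^ 4)"
    if "k < 2 ^ m" "0 < x" for m k x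
  proof -
    have "p m (Suc k) - p m k = T / 2 ^ m" by (simp add: p_def field_simps)
    moreover have "p m k < p m (Suc k)" "0 \<le> p m k"
      using T by (auto simp: p_def intro!: divide_strict_right_mono)
    ultimately have "distributed M lborel (\<lambda>\<omega>. W (p m (Suc k)) \<omega> - W (p m k) \<omega>) (normal_density 0 (sqrt (T / 2 ^ m)))"
      using bm_increment[OF W, of "p m k" "p m (Suc k)"] by simp
    from normal_tail_fourth_moment[OF this _ that(2)]
    have "prob {\<omega> \<in> space M. x < \<bar>W (p m (Suc k)) \<omega> - W (p m k) \<omega>\<bar>} \<le> 3 * sqrt (T / 2 ^ m) ^ (2 * 2) / x ^ 4"
      using T by simp
    also have "sqrt (T / 2 ^ m) ^ (2 * 2) = T\<^sup>2 / 4 ^ m"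
    proof -
      have "((2::real) ^ m)\<^sup>2 = 4 ^ m" by (simp add: power2_eq_square flip: power_mult_distrib)
      then show ?thesis unfolding power_mult using T by (simp add: power_divide)
    qed
    finally show ?thesis by simp
  qed
  note * = chaining_tail_bound[OF pe sets.top meas tail x]
  show "{\<omega> \<in> space M. \<exists>m. \<exists>k\<le>2 ^ m. x < \<bar>W (T * real k / 2 ^ m) \<omega> - W 0 \<omega>\<bar>} \<in> events"
    using *(1) by (simp only: p_def)
  show "prob {\<omega> \<in> space M. \<exists>m. \<exists>k\<le>2 ^ m. x < \<bar>W (T * real k / 2 ^ m) \<omega> - W 0 \<omega>\<bar>}
      \<le> 150000 * T\<^sup>2 / x ^ 4"
    using *(2) by (simp add: p_def)
qed

lemma bm_sup_tail_imp:
  fixes w :: "real \<Rightarrow> real"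
  assumes "continuous_on {0..} w" and "w 0 = 0"
    and "\<not> (\<exists>m. \<exists>k\<le>2 ^ m. x < \<bar>w (T * real k / 2 ^ m) - w 0\<bar>)"
    and "0 \<le> t" "t \<le> T"
  shows "\<bar>w t\<bar> \<le> x"
  using le_of_dyadic_le[of 0 T w x t] assms continuous_on_subset[OF assms(1)] by (force simp: not_less)

text \<open>
  At the scales \<open>T = 2\<^sup>n\<close> the probability that the maximum up to \<open>T\<close> exceeds \<open>T / (j + 1)\<close> is of
  order \<open>4\<^bsup>-n\<^esup>\<close>, so Borel and Cantelli apply for every \<open>j\<close>.
\<close>

lemma bm_sublinear:
  assumes W: "standard_brownian_motion W"
  shows "AE \<omega> in M. ((\<lambda>t. W t \<omega> / t) \<longlongrightarrow> 0) at_top"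
proof -
  define G where "G = (\<lambda>(j::nat) (n::nat). {\<omega> \<in> space M. \<exists>m. \<exists>k\<le>2 ^ m.
      2 ^ n / real (Suc j) < \<bar>W (2 ^ n * real k / 2 ^ m) \<omega> - W 0 \<omega>\<bar>})"
  have "AE \<omega> in M. \<forall>j. \<forall>\<^sub>F n in sequentially. \<omega> \<in> space M - G j n"
  proof (rule AE_all_countable[THEN iffD2, rule_format], rule borel_cantelli_AE1)
    fix j :: nat
    show Gm: "G j n \<in> events" for n unfolding G_def by (rule bm_sup_tail[OF W]) auto
    show "emeasure M (G j n) < \<infinity>" for n by (simp add: emeasure_eq_measure)
    show "summable (\<lambda>n. prob (G j n))"
    proof (rule summable_comparison_test')
      show "summable (\<lambda>n. 150000 * real (Suc j) ^ 4 * (1 / 4) ^ n)"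
        by (intro summable_mult summable_geometric) simp
      fix n :: nat
      have "prob (G j n) \<le> 150000 * (2 ^ n)\<^sup>2 / (2 ^ n / real (Suc j)) ^ 4"
        unfolding G_def by (rule bm_sup_tail[OF W]) auto
      also have "\<dots> = 150000 * real (Suc j) ^ 4 * (1 / 4) ^ n"
      proof -
        have "((2::real) ^ n) ^ 4 = (2 ^ n)\<^sup>2 * 4 ^ n"
          by (simp add: power4_eq_xxxx power2_eq_square flip: power_mult_distrib)
        then show ?thesis by (simp add: power_divide field_simps)
      qed
      finally show "norm (prob (G j n)) \<le> 150000 * real (Suc j) ^ 4 * (1 / 4) ^ n" by simp
    qed
  qed
  moreover have "AE \<omega> in M. W 0 \<omega> = 0" "AE \<omega> in M. continuous_on {0..} (\<lambda>t. W t \<omega>)"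
    using W by (auto simp: standard_brownian_motion_def)
  ultimately show ?thesis
  proof eventually_elim
    case (elim \<omega>)
    show ?case
    proof (rule tendstoI)
      fix e :: real assume e: "0 < e"
      then obtain j where j: "1 / real (Suc j) < e / 2" using nat_approx_posE[of "e / 2"] by auto
      obtain n0 where n0: "\<And>n. n0 \<le> n \<Longrightarrow> \<omega> \<in> space M - G j n"
        using elim(1) by (auto simp: eventually_sequentially)
      show "\<forall>\<^sub>F t in at_top. dist (W t \<omega> / t) 0 < e"
        using eventually_ge_at_top[of "2 ^ n0"]
      proof eventually_elim
        case (elim t)
        have t1: "1 \<le> t" using elim one_le_power[of "2::real" n0] by linarith
        define n where "n = nat \<lfloor>log 2 t\<rfloor>"
        have lt: "0 \<le> log 2 t" using t1 by simp
        then have nl: "real n \<le> log 2 t" "log 2 t < real (Suc n)" unfolding n_def by auto linarith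
        have "(2::real) ^ n = 2 powr real n" by (simp add: powr_realpow)
        also have "\<dots> \<le> t" using nl t1 by (simp add: le_log_iff)
        finally have a: "2 ^ n \<le> t" .
        have "t < 2 powr real (Suc n)" using nl t1 by (simp add: log_less_iff)
        also have "\<dots> = 2 ^ Suc n" by (simp only: powr_realpow)
        finally have b: "t \<le> 2 ^ Suc n" by simp
        have "t < 2 ^ Suc n" using \<open>t < 2 powr real (Suc n)\<close> by (simp only: powr_realpow)
        with elim have "(2::real) ^ n0 < 2 ^ Suc n" by (rule le_less_trans)
        then have "n0 < Suc n" by (rule power_less_imp_less_exp[rotated]) simp
        then have "\<omega> \<in> space M - G j (Suc n)" by (intro n0) auto
        then have "\<bar>W t \<omega>\<bar> \<le> 2 ^ Suc n / real (Suc j)"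
          by (intro bm_sup_tail_imp[where T = "2 ^ Suc n" and w = "\<lambda>t. W t \<omega>"])
             (use \<open>W 0 \<omega> = 0\<close> \<open>continuous_on {0..} (\<lambda>t. W t \<omega>)\<close> t1 b in \<open>auto simp: G_def simp del: power_Suc\<close>)
        also have "\<dots> \<le> 2 * t * (1 / real (Suc j))" using a by (simp add: divide_right_mono)
        also have "\<dots> < 2 * t * (e / 2)" using t1 j by (intro mult_strict_left_mono) auto
        finally show ?case using t1 by (simp add: abs_divide divide_simps mult.commute)
      qed
    qed
  qed
qed

end

section \<open>The radial equation along one path\<close>

definition coth_drift :: "real \<Rightarrow> real" where "coth_drift x = 1 / (2 * tanh x)"

lemma coth_drift_antimono:
  assumes "0 < x" "x \<le> y" shows "coth_drift y \<le> coth_drift x"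
proof -
  have "0 < tanh x" "tanh x \<le> tanh y" using assms by auto
  then show ?thesis unfolding coth_drift_def by (intro divide_left_mono mult_pos_pos) auto
qed

lemma coth_drift_gt_half: "0 < x \<Longrightarrow> 1 / 2 < coth_drift x"
  using tanh_real_lt_1[of x] by (simp add: coth_drift_def field_simps)

lemma coth_drift_eq: "0 < x \<Longrightarrow> coth_drift x = 1 / 2 + 1 / (exp (2 * x) - 1)"
proof -
  assume "0 < x"
  then have "1 < exp (2 * x)" by simp
  moreover have "coth_drift x = 1 / (2 * ((1 - 1 / exp (2 * x)) / (1 + 1 / exp (2 * x))))"
    by (simp add: coth_drift_def tanh_real_altdef exp_minus inverse_eq_divide)
  moreover have "1 / (2 * ((1 - 1 / y) / (1 + 1 / y))) = 1 / 2 + 1 / (y - 1)" if "1 < y" for y :: real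
    using that by (simp add: field_simps)
  ultimately show ?thesis by simp
qed

lemma coth_drift_tendsto: "(coth_drift \<longlongrightarrow> 1 / 2) at_top"
proof -
  have "((\<lambda>x::real. 1 / (2 * tanh x)) \<longlongrightarrow> 1 / (2 * 1)) at_top"
    by (rule tendsto_divide[OF tendsto_const tendsto_mult[OF tendsto_const tanh_real_at_top]]) simp
  then show ?thesis by (simp add: coth_drift_def[abs_def])
qed

text \<open>
  A single path \<open>r\<close> of the radial process, driven by the path \<open>w\<close>. With the noise additive, the radius
  is controlled path by path, and probability enters only through the growth of \<open>w\<close>.
\<close>

locale radial_path =
  fixes r w :: "real \<Rightarrow> real"
  assumes cont: "continuous_on {0..} r"
    and pos: "\<And>t. 0 < t \<Longrightarrow> 0 < r t"
    and zero: "r 0 = 0"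
    and integrable: "\<And>t. 0 \<le> t \<Longrightarrow> set_integrable lborel {0..t} (\<lambda>u. coth_drift (r u))"
    and eq: "\<And>t. 0 \<le> t \<Longrightarrow> r t = (LINT u:{0..t}|lborel. coth_drift (r u)) + w t"
begin

lemma nonneg: "0 \<le> t \<Longrightarrow> 0 \<le> r t"
  using pos[of t] zero by (cases "t = 0") auto

lemma integrable_Ioc:
  assumes "0 \<le> s" "s \<le> t"
  shows "set_integrable lborel {s<..t} (\<lambda>u. coth_drift (r u))"
  by (rule set_integrable_subset[OF integrable[of t]]) (use assms in auto)

lemma increment:
  assumes "0 \<le> s" "s \<le> t"
  shows "r t - r s = (LINT u:{s<..t}|lborel. coth_drift (r u)) + (w t - w s)"
proof -
  have "(LINT u:{0..t}|lborel. coth_drift (r u)) =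
      (LINT u:{0..s}|lborel. coth_drift (r u)) + (LINT u:{s<..t}|lborel. coth_drift (r u))"
  proof -
    have "{0..t} = {0..s} \<union> {s<..t}" using assms by auto
    then show ?thesis
      by (simp only:) (rule set_integral_Un, use assms integrable integrable_Ioc in auto)
  qed
  then show ?thesis using eq[of s] eq[of t] assms by simp
qed

lemma increment_le:
  assumes "0 \<le> s" "s \<le> t" and "\<And>u. s < u \<Longrightarrow> u \<le> t \<Longrightarrow> coth_drift (r u) \<le> c"
  shows "r t - r s \<le> c * (t - s) + (w t - w s)"
proof -
  have "(LINT u:{s<..t}|lborel. coth_drift (r u)) \<le> (LINT u:{s<..t}|lborel. c)"
    by (rule set_integral_mono[OF integrable_Ioc]) (use assms in \<open>auto simp: set_integrable_def\<close>)
  then show ?thesis using increment[OF assms(1,2)] assms(1,2) by (simp add: mult.commute set_lebesgue_integral_def)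
qed

lemma increment_ge:
  assumes "0 \<le> s" "s \<le> t" and "\<And>u. s < u \<Longrightarrow> u \<le> t \<Longrightarrow> c \<le> coth_drift (r u)"
  shows "c * (t - s) + (w t - w s) \<le> r t - r s"
proof -
  have "(LINT u:{s<..t}|lborel. c) \<le> (LINT u:{s<..t}|lborel. coth_drift (r u))"
    by (rule set_integral_mono[OF _ integrable_Ioc]) (use assms in \<open>auto simp: set_integrable_def\<close>)
  then show ?thesis using increment[OF assms(1,2)] assms(1,2) by (simp add: mult.commute set_lebesgue_integral_def)
qed

lemma w0: "w 0 = 0"
proof -
  have "(LINT u:{0..0}|lborel. coth_drift (r u)) = 0"
    unfolding set_lebesgue_integral_def
    by (rule integral_eq_zero_AE, rule AE_mp[OF AE_lborel_singleton[of 0]]) auto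
  then show ?thesis using eq[of 0] zero by simp
qed

lemma lower_bound: "0 \<le> t \<Longrightarrow> t / 2 + w t \<le> r t"
  using increment_ge[of 0 t "1 / 2"] coth_drift_gt_half[OF pos] zero w0 by force

text \<open>
  After the last time before \<open>t\<close> at which the path is at most \<open>K\<close>, the drift is at most
  \<open>coth_drift K\<close>.
\<close>

lemma upper_bound:
  assumes K: "0 < K" and t: "0 \<le> t" and S: "\<And>u. 0 \<le> u \<Longrightarrow> u \<le> t \<Longrightarrow> \<bar>w u\<bar> \<le> S"
  shows "r t \<le> K + coth_drift K * t + 2 * S"
proof -
  have cK: "0 \<le> coth_drift K" using coth_drift_gt_half[OF K] by simp
  \<comment> \<open>The supremum of this compact set is the last visit below \<open>K\<close>; \<open>r 0 = 0\<close> makes it nonempty.\<close>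
  define Z where "Z = {u \<in> {0..t}. r u \<le> K}"
  have Z0: "0 \<in> Z" using K t zero by (auto simp: Z_def)
  have "closed Z" unfolding Z_def
    by (intro continuous_on_closed_Collect_le continuous_on_subset[OF cont] continuous_intros) auto
  moreover have bdd: "bdd_above Z" unfolding Z_def by (rule bdd_aboveI[of _ t]) auto
  ultimately have s: "Sup Z \<in> Z" using Z0 by (intro closed_contains_Sup) auto
  define s where "s = Sup Z"
  have s: "0 \<le> s" "s \<le> t" "r s \<le> K" using s by (auto simp: Z_def s_def)
  have gt: "K < r u" if "s < u" "u \<le> t" for u
  proof (rule ccontr)
    assume "\<not> K < r u"
    then have "u \<in> Z" using that s by (auto simp: Z_def)
    then have "u \<le> s" unfolding s_def by (rule cSup_upper[OF _ bdd])
    with that show False by simp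
  qed
  have "r t - r s \<le> coth_drift K * (t - s) + (w t - w s)"
    by (rule increment_le) (use s K gt in \<open>auto intro!: coth_drift_antimono intro: less_imp_le\<close>)
  moreover have "coth_drift K * (t - s) \<le> coth_drift K * t" using cK s by (intro mult_left_mono) auto
  ultimately show ?thesis using s S[of s] S[of t] t by (simp add: abs_le_iff)
qed

text \<open>
  The deviation \<open>D\<close> is the integral of the excess drift \<open>coth_drift (r u) - 1/2 \<ge> 0\<close>. The lower bound
  for \<open>r\<close> gives \<open>r u \<ge> u / 4\<close> for large \<open>u\<close>, so \<open>D\<close> gains at most \<open>2 e\<^bsup>-v/2\<^esup>\<close> over \<open>[v, v + 1]\<close>, and these
  gains form a convergent geometric series.
\<close>

lemma deviation_bounded:
  assumes lim: "((\<lambda>t. w t / t) \<longlongrightarrow> 0) at_top"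
  shows "\<exists>C. \<forall>t\<ge>0. \<bar>r t - w t - t / 2\<bar> \<le> C"
proof -
  define D where "D = (\<lambda>t. r t - w t - t / 2)"
  have D_mono: "D s \<le> D t" if "0 \<le> s" "s \<le> t" for s t
    using increment_ge[OF that, of "1 / 2"] coth_drift_gt_half[OF pos] that
    by (simp add: D_def less_imp_le field_simps)
  have D0: "D 0 = 0" using zero w0 by (simp add: D_def)
  have "\<forall>\<^sub>F t in at_top. \<bar>w t / t\<bar> < 1 / 4"
    using tendstoD[OF lim, of "1 / 4"] by simp
  then obtain N0 where N0: "\<And>t. N0 \<le> t \<Longrightarrow> \<bar>w t / t\<bar> < 1 / 4"
    by (auto simp: eventually_at_top_linorder)
  define N where "N = max N0 2"
  have N2: "2 \<le> N" and "N0 \<le> N" by (auto simp: N_def)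
  have linear: "u / 4 \<le> r u" if "N \<le> u" for u
    using N0[of u] that N2 \<open>N0 \<le> N\<close> lower_bound[of u] by (auto simp: abs_less_iff field_simps)
  have drift: "coth_drift (r u) \<le> 1 / 2 + 2 * exp (- v / 2)" if "N \<le> v" "v \<le> u" for u v
  proof -
    have "coth_drift (r u) \<le> coth_drift (v / 4)"
      using linear[of u] that N2 by (intro coth_drift_antimono) auto
    also have "\<dots> = 1 / 2 + 1 / (exp (v / 2) - 1)" using that N2 by (simp add: coth_drift_eq)
    also have "1 / (exp (v / 2) - 1) \<le> 2 * exp (- v / 2)"
    proof -
      have "2 \<le> exp (v / 2)" using exp_ge_add_one_self[of "v / 2"] that N2 by linarith
      then have "exp (v / 2) / (exp (v / 2) - 1) \<le> 2" using that N2 by (subst pos_divide_le_eq) auto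
      then show ?thesis by (simp add: exp_minus field_simps)
    qed
    finally show ?thesis by simp
  qed
  have step: "D (v + 1) \<le> D v + 2 * exp (- v / 2)" if "N \<le> v" for v
    using increment_le[of v "v + 1" "1 / 2 + 2 * exp (- v / 2)"] drift[of v] that N2
    by (simp add: D_def field_simps)
  have sum: "D (N + real k) \<le> D N + (\<Sum>j<k. 2 * exp (- (1 / 2)) ^ j)" for k
  proof (induction k)
    case (Suc k)
    have "D (N + real (Suc k)) \<le> D (N + real k) + 2 * exp (- (N + real k) / 2)"
      using step[of "N + real k"] by (simp add: add_ac)
    also have "exp (- (N + real k) / 2) \<le> exp (- (1 / 2)) ^ k"
      using N2 by (simp flip: exp_of_nat_mult)
    finally show ?case using Suc.IH by simp
  qed simp
  define C where "C = D N + (\<Sum>j. 2 * exp (- (1 / 2)) ^ j)"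
  have "\<bar>D t\<bar> \<le> C" if "0 \<le> t" for t
  proof -
    obtain k where k: "t \<le> N + real k" using real_arch_simple[of "t - N"] by (auto simp: algebra_simps)
    have "D t \<le> D (N + real k)" using D_mono[OF that k] .
    also have "\<dots> \<le> D N + (\<Sum>j<k. 2 * exp (- (1 / 2)) ^ j)" by (rule sum)
    also have "\<dots> \<le> C" unfolding C_def
      by (intro add_left_mono sum_le_suminf summable_mult summable_geometric) auto
    finally show ?thesis using D_mono[of 0 t] that D0 by simp
  qed
  then show ?thesis unfolding D_def by blast
qed

lemma speed:
  assumes lim: "((\<lambda>t. w t / t) \<longlongrightarrow> 0) at_top"
  shows "((\<lambda>t. r t / t) \<longlongrightarrow> 1 / 2) at_top"
proof -
  obtain C where C: "\<And>t. 0 \<le> t \<Longrightarrow> \<bar>r t - w t - t / 2\<bar> \<le> C"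
    using deviation_bounded[OF lim] by blast
  have "((\<lambda>t. (r t - w t - t / 2) / t) \<longlongrightarrow> 0) at_top"
  proof (rule Lim_null_comparison)
    show "\<forall>\<^sub>F t in at_top. norm ((r t - w t - t / 2) / t) \<le> C / t"
      using eventually_gt_at_top[of 0]
    proof eventually_elim
      case (elim t)
      then show ?case using C[of t] by (simp add: abs_divide divide_right_mono)
    qed
    show "((\<lambda>t. C / t) \<longlongrightarrow> 0) at_top"
      by (rule tendsto_divide_0[OF tendsto_const filterlim_at_top_imp_at_infinity[OF filterlim_ident]])
  qed
  then have "((\<lambda>t. (r t - w t - t / 2) / t + w t / t + 1 / 2) \<longlongrightarrow> 0 + 0 + 1 / 2) at_top"
    by (intro tendsto_intros lim)
  moreover have "\<forall>\<^sub>F t in at_top. (r t - w t - t / 2) / t + w t / t + 1 / 2 = r t / t"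
    using eventually_gt_at_top[of 0] by eventually_elim (simp add: field_simps)
  ultimately show ?thesis by (simp add: tendsto_cong)
qed

end

section \<open>The radius as a functional of its driving path\<close>

text \<open>
  For \<open>h > 0\<close>, the solution \<open>x > 0\<close> of \<open>x - h * coth_drift x = y\<close>, that is, the resolvent of the drift. Written as a
  supremum it is visibly monotone in \<open>y\<close>, hence Borel.
\<close>

definition implicit_step :: "real \<Rightarrow> real \<Rightarrow> real" where
  "implicit_step h y = Sup (insert 0 {x. 0 < x \<and> x - h * coth_drift x \<le> y})"

lemma implicit_step_bdd:
  assumes "0 < h"
  shows "bdd_above (insert 0 {x. 0 < x \<and> x - h * coth_drift x \<le> y})"
proof (rule bdd_aboveI[of _ "max 1 (y + h * coth_drift 1)"])
  fix x assume x: "x \<in> insert 0 {x. 0 < x \<and> x - h * coth_drift x \<le> y}"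
  show "x \<le> max 1 (y + h * coth_drift 1)"
  proof (cases "1 \<le> x")
    case True
    then have "h * coth_drift x \<le> h * coth_drift 1"
      using assms by (intro mult_left_mono coth_drift_antimono) auto
    then show ?thesis using x True by auto
  qed auto
qed

lemma implicit_step_mono: "0 < h \<Longrightarrow> mono (implicit_step h)"
  unfolding implicit_step_def by (intro monoI cSup_subset_mono implicit_step_bdd) auto

lemma implicit_step_measurable [measurable]: "0 < h \<Longrightarrow> implicit_step h \<in> borel_measurable borel"
  by (rule borel_measurable_mono[OF implicit_step_mono])

text \<open>
  Since the drift decreases, \<open>x \<mapsto> x - h * coth_drift x\<close> has slope at least one, so its inverse does not
  increase distances.
\<close>

lemma implicit_step_contraction:
  assumes h: "0 < h" and x: "0 < x"
  shows "\<bar>implicit_step h y - x\<bar> \<le> \<bar>y - (x - h * coth_drift x)\<bar>"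
proof -
  let ?A = "insert 0 {x. 0 < x \<and> x - h * coth_drift x \<le> y}" and ?d = "y - (x - h * coth_drift x)"
  have "implicit_step h y \<le> x + \<bar>?d\<bar>"
    unfolding implicit_step_def
  proof (rule cSup_least)
    fix z assume z: "z \<in> ?A"
    show "z \<le> x + \<bar>?d\<bar>"
    proof (cases "z \<le> x")
      case False
      then have "h * coth_drift z \<le> h * coth_drift x"
        using h x by (intro mult_left_mono coth_drift_antimono) auto
      then show ?thesis using z False x by auto
    qed auto
  qed simp
  moreover have "x - \<bar>?d\<bar> \<le> implicit_step h y"
  proof (cases "0 < x - \<bar>?d\<bar>")
    case True
    then have "h * coth_drift x \<le> h * coth_drift (x - \<bar>?d\<bar>)"
      using h by (intro mult_left_mono coth_drift_antimono) auto
    then have "x - \<bar>?d\<bar> \<in> ?A" using True by auto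
    then show ?thesis unfolding implicit_step_def by (rule cSup_upper[OF _ implicit_step_bdd[OF h]])
  next
    case False
    moreover have "0 \<le> implicit_step h y"
      unfolding implicit_step_def by (rule cSup_upper[OF _ implicit_step_bdd[OF h]]) simp
    ultimately show ?thesis by linarith
  qed
  ultimately show ?thesis by linarith
qed

primrec implicit_euler :: "real \<Rightarrow> real \<Rightarrow> (real \<Rightarrow> real) \<Rightarrow> nat \<Rightarrow> real" where
  "implicit_euler a h w 0 = 0"
| "implicit_euler a h w (Suc k) =
     implicit_step h (implicit_euler a h w k + (w (a + real (Suc k) * h) - w (a + real k * h)))"

abbreviation path_space :: "(real \<Rightarrow> real) measure" where
  "path_space \<equiv> \<Pi>\<^sub>M t\<in>{0..}. borel"

lemma implicit_euler_measurable:
  assumes "0 \<le> a" "0 < h"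
  shows "(\<lambda>w. implicit_euler a h w k) \<in> borel_measurable path_space"
proof (induction k)
  case (Suc k)
  note [measurable] = Suc.IH implicit_step_measurable[OF assms(2)]
  have [measurable]: "(\<lambda>w. w (a + real k * h)) \<in> borel_measurable path_space" for k
    using assms by (intro measurable_component_singleton) auto
  show ?case unfolding implicit_euler.simps by measurable
qed simp

text \<open>
  The implicit Euler schemes start at the times \<open>a = t / (m + 2)\<close>, since the drift is continuous along
  the path only away from the origin. Their starting value \<open>0\<close> replaces the unknown \<open>r a\<close>; as the mesh
  tends to zero this leaves an error of at most \<open>r a\<close>, so a limit superior over the mesh suffices, and
  the error vanishes as \<open>m\<close> grows.
\<close>

definition radial_functional :: "real \<Rightarrow> (real \<Rightarrow> real) \<Rightarrow> real" where
  "radial_functional t w = lim (\<lambda>m. real_of_ereal (limsup (\<lambda>n.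
     let a = t / real (m + 2) in ereal (implicit_euler a ((t - a) / real (Suc n)) w (Suc n)))))"

lemma radial_functional_measurable:
  assumes "0 < t" shows "radial_functional t \<in> borel_measurable path_space"
proof -
  have "(\<lambda>w. implicit_euler (t / real (m + 2)) ((t - t / real (m + 2)) / real (Suc n)) w (Suc n))
      \<in> borel_measurable path_space" for m n
  proof (rule implicit_euler_measurable)
    have "t * 1 < t * real (m + 2)" using assms by (intro mult_strict_left_mono) auto
    then have "t / real (m + 2) < t" by (simp add: pos_divide_less_eq)
    then show "0 < (t - t / real (m + 2)) / real (Suc n)" by simp
  qed (use assms in simp)
  then show ?thesis unfolding radial_functional_def[abs_def] Let_def by measurable
qed

context radial_path
begin

text \<open>
  The contraction property propagates the initial error \<open>r a\<close> without amplification, and each step adds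
  at most \<open>h\<close> times the oscillation of the drift along the path within one step.
\<close>

lemma implicit_euler_error:
  assumes a: "0 < a" and h: "0 < h" and \<eta>: "0 \<le> \<eta>"
    and osc: "\<And>u v. a \<le> u \<Longrightarrow> u \<le> v \<Longrightarrow> v \<le> u + h \<Longrightarrow> v \<le> a + real k * h \<Longrightarrow>
        \<bar>coth_drift (r u) - coth_drift (r v)\<bar> \<le> \<eta>"
  shows "\<bar>implicit_euler a h w k - r (a + real k * h)\<bar> \<le> r a + real k * h * \<eta>"
  using osc
proof (induction k)
  case 0
  then show ?case using nonneg[of a] a by simp
next
  case (Suc k)
  define s t where "s = a + real k * h" and "t = a + real (Suc k) * h"
  have st: "t = s + h" "0 < s" using a h by (simp_all add: s_def t_def algebra_simps add_pos_nonneg)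
  have as: "a \<le> s" using h by (simp add: s_def)
  have IH: "\<bar>implicit_euler a h w k - r s\<bar> \<le> r a + real k * h * \<eta>"
    unfolding s_def by (rule Suc.IH) (use Suc.prems h in \<open>auto simp: algebra_simps\<close>)
  have osc: "\<bar>coth_drift (r u) - coth_drift (r t)\<bar> \<le> \<eta>" if "s < u" "u \<le> t" for u
    by (rule Suc.prems) (use that st as in \<open>auto simp: t_def\<close>)
  have up: "r t - r s \<le> (coth_drift (r t) + \<eta>) * (t - s) + (w t - w s)"
    by (rule increment_le) (use st h osc in \<open>auto simp: abs_le_iff algebra_simps\<close>)
  have lo: "(coth_drift (r t) - \<eta>) * (t - s) + (w t - w s) \<le> r t - r s"
    by (rule increment_ge) (use st h osc in \<open>auto simp: abs_le_iff algebra_simps\<close>)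
  let ?y = "implicit_euler a h w k + (w t - w s)"
  have "\<bar>implicit_step h ?y - r t\<bar> \<le> \<bar>?y - (r t - h * coth_drift (r t))\<bar>"
    using st h by (intro implicit_step_contraction pos) auto
  also have "\<dots> \<le> \<bar>implicit_euler a h w k - r s\<bar> + h * \<eta>"
  proof -
    have "\<bar>h * coth_drift (r t) - (r t - r s) + (w t - w s)\<bar> \<le> h * \<eta>"
      using up lo st by (simp add: abs_le_iff algebra_simps)
    then show ?thesis by linarith
  qed
  also have "\<dots> \<le> r a + real (Suc k) * h * \<eta>" using IH by (simp add: algebra_simps)
  finally show ?case by (simp add: s_def t_def)
qed

lemma implicit_euler_limsup:
  assumes a: "0 < a" "a < t"
  shows "\<bar>real_of_ereal (limsup (\<lambda>n. ereal (implicit_euler a ((t - a) / real (Suc n)) w (Suc n)))) - r t\<bar> \<le> r a"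
    (is "\<bar>real_of_ereal (limsup ?E) - r t\<bar> \<le> r a")
proof -
  have close: "\<forall>\<^sub>F n in sequentially. ereal (r t - r a - \<eta>) \<le> ?E n \<and> ?E n \<le> ereal (r t + r a + \<eta>)" if "0 < \<eta>" for \<eta>
  proof -
    define e where "e = \<eta> / (t - a)"
    have e: "0 < e" using that a by (simp add: e_def)
    have "continuous_on {a..t} (\<lambda>u. coth_drift (r u))"
      unfolding coth_drift_def
      by (intro continuous_intros continuous_on_subset[OF cont])
        (use pos a in \<open>force simp: less_imp_neq[symmetric] intro: continuous_on_subset[OF cont]\<close>)+
    then have "uniformly_continuous_on {a..t} (\<lambda>u. coth_drift (r u))"
      by (rule compact_uniformly_continuous) simp
    then obtain d where d: "0 < d" and osc: "\<And>u v. u \<in> {a..t} \<Longrightarrow> v \<in> {a..t} \<Longrightarrow> dist v u < d \<Longrightarrow>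
        dist (coth_drift (r v)) (coth_drift (r u)) < e"
      using e unfolding uniformly_continuous_on_def by blast
    have "(\<lambda>n. (t - a) / real (Suc n)) \<longlonglongrightarrow> 0"
      by (rule LIMSEQ_Suc[OF lim_const_over_n])
    then have "\<forall>\<^sub>F n in sequentially. (t - a) / real (Suc n) < d"
      using d by (rule order_tendstoD)
    then show ?thesis
    proof eventually_elim
      case (elim n)
      define h where "h = (t - a) / real (Suc n)"
      have h: "0 < h" using a by (simp add: h_def)
      have t: "a + real (Suc n) * h = t" by (simp add: h_def)
      have "\<bar>implicit_euler a h w (Suc n) - r (a + real (Suc n) * h)\<bar> \<le> r a + real (Suc n) * h * e"
      proof (rule implicit_euler_error[OF a(1) h])
        fix u v assume uv: "a \<le> u" "u \<le> v" "v \<le> u + h" "v \<le> a + real (Suc n) * h"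
        then have "dist u v < d" using elim by (simp add: h_def dist_real_def)
        from osc[OF _ _ this] show "\<bar>coth_drift (r u) - coth_drift (r v)\<bar> \<le> e"
          using uv unfolding t by (auto simp: dist_real_def)
      qed (use e in auto)
      also have "real (Suc n) * h * e = \<eta>" using a by (simp add: h_def e_def)
      finally show ?case unfolding t by (simp add: h_def abs_le_iff)
    qed
  qed
  have up: "limsup ?E \<le> ereal (r t + r a + \<eta>)" if "0 < \<eta>" for \<eta>
    by (rule Limsup_bounded) (use close[OF that] in \<open>auto elim: eventually_mono\<close>)
  have lo: "ereal (r t - r a - \<eta>) \<le> limsup ?E" if "0 < \<eta>" for \<eta>
  proof -
    have "ereal (r t - r a - \<eta>) \<le> liminf ?E"
      by (rule Liminf_bounded) (use close[OF that] in \<open>auto elim: eventually_mono\<close>)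
    also have "\<dots> \<le> limsup ?E" by (rule Liminf_le_Limsup) simp
    finally show ?thesis .
  qed
  obtain l where l: "limsup ?E = ereal l"
    using up[of 1] lo[of 1] by (cases "limsup ?E") auto
  have "l \<le> r t + r a" by (rule field_le_epsilon) (use up l in auto)
  moreover have "r t - r a \<le> l" by (rule field_le_epsilon) (use lo l in \<open>force simp: algebra_simps\<close>)
  ultimately show ?thesis unfolding l by (simp add: abs_le_iff)
qed

lemma radial_functional_eq:
  assumes t: "0 < t" shows "radial_functional t w = r t"
proof -
  define g where "g = (\<lambda>m. real_of_ereal (limsup (\<lambda>n.
     let a = t / real (m + 2) in ereal (implicit_euler a ((t - a) / real (Suc n)) w (Suc n)))))"
  have "(\<lambda>m. t / real m) \<longlonglongrightarrow> 0" by (rule lim_const_over_n)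
  then have a0: "(\<lambda>m. t / real (m + 2)) \<longlonglongrightarrow> 0" by (rule LIMSEQ_ignore_initial_segment)
  have ra: "(\<lambda>m. r (t / real (m + 2))) \<longlonglongrightarrow> 0"
    using continuous_on_tendsto_compose[OF cont a0] t zero by simp
  have "(\<lambda>m. g m - r t) \<longlonglongrightarrow> 0"
  proof (rule Lim_null_comparison[OF _ ra])
    show "\<forall>\<^sub>F m in sequentially. norm (g m - r t) \<le> r (t / real (m + 2))"
    proof (intro always_eventually allI)
      fix m
      have "t * 1 < t * real (m + 2)" using t by (intro mult_strict_left_mono) auto
      then have "0 < t / real (m + 2)" "t / real (m + 2) < t" using t by (simp_all add: pos_divide_less_eq)
      from implicit_euler_limsup[OF this] show "norm (g m - r t) \<le> r (t / real (m + 2))"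
        by (simp add: g_def Let_def)
    qed
  qed
  then have "g \<longlonglongrightarrow> r t" by (simp add: LIM_zero_iff)
  then show ?thesis unfolding radial_functional_def g_def[symmetric] by (rule limI)
qed

text \<open>
  Random elements of \<open>path_space\<close> are extensional functions, so a path is restricted to \<open>[0, \<infinity>)\<close>.
\<close>

lemma restrict_path: "radial_path r (restrict w {0..})"
  using cont pos zero integrable eq by unfold_locales auto

end

section \<open>Speed of the radial process\<close>

text \<open>
  Layer-cake summation in steps of length \<open>l\<close>: \<open>Z\<close> is at most \<open>c + l\<close> plus \<open>l\<close> times the number of
  levels \<open>c + (n + 1) l\<close> below \<open>Z\<close>.
\<close>

lemma (in prob_space) quartic_tail_expectation:
  assumes Z [measurable]: "random_variable borel Z" and Z0: "AE \<omega> in M. 0 \<le> Z \<omega>"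
    and c: "0 \<le> c" and l: "0 < l" and C: "0 \<le> C"
    and tail: "\<And>n. prob {\<omega> \<in> space M. c + real (Suc n) * l < Z \<omega>} \<le> C / real (Suc n) ^ 4"
  shows "integrable M Z" and "expectation Z \<le> c + l * (1 + C * (\<Sum>n. 1 / real (Suc n) ^ 4))"
proof -
  define A where "A = (\<lambda>n. {\<omega> \<in> space M. c + real (Suc n) * l < Z \<omega>})"
  have A [measurable]: "A n \<in> events" for n unfolding A_def by measurable
  have sm: "summable (\<lambda>n. 1 / real (Suc n) ^ 4)"
    using inverse_power_summable[of 4, where ?'a = real] by (subst summable_Suc_iff) (simp add: divide_inverse)
  define b where "b = c + l * (1 + C * (\<Sum>n. 1 / real (Suc n) ^ 4))"
  have s0: "0 \<le> (\<Sum>n. 1 / real (Suc n) ^ 4)" by (intro suminf_nonneg sm) auto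
  have pt: "ennreal (Z \<omega>) \<le> ennreal (c + l) + (\<Sum>n. ennreal l * indicator (A n) \<omega>)" if w: "\<omega> \<in> space M" for \<omega>
  proof (cases "Z \<omega> \<le> c + l")
    case True
    then show ?thesis by (metis add_increasing2 ennreal_leI zero_le)
  next
    case False
    \<comment> \<open>The number of levels strictly below \<open>Z \<omega>\<close>; the ceiling minus one is needed for strictness.\<close>
    define N where "N = nat (\<lceil>(Z \<omega> - c) / l\<rceil> - 1)"
    have g: "1 < (Z \<omega> - c) / l" using False l by (simp add: field_simps)
    then have "real N < (Z \<omega> - c) / l" "(Z \<omega> - c) / l \<le> real N + 1" unfolding N_def by linarith+
    then have N: "c + real N * l < Z \<omega>" "Z \<omega> \<le> c + l + real N * l" using l by (simp_all add: field_simps)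
    have "\<omega> \<in> A n" if "n < N" for n
    proof -
      have "real (Suc n) * l \<le> real N * l" using that l by (intro mult_right_mono) auto
      then have "c + real (Suc n) * l < Z \<omega>" using N by linarith
      then show ?thesis using w by (simp add: A_def)
    qed
    then have "(\<Sum>n<N. ennreal l * indicator (A n) \<omega>) = ennreal (real N * l)"
      using l by (simp add: ennreal_mult ennreal_of_nat_eq_real_of_nat)
    moreover have "(\<Sum>n<N. ennreal l * indicator (A n) \<omega>) \<le> (\<Sum>n. ennreal l * indicator (A n) \<omega>)"
      by (rule sum_le_suminf) auto
    moreover have "ennreal (Z \<omega>) \<le> ennreal (c + l) + ennreal (real N * l)"
    proof -
      have "ennreal (Z \<omega>) \<le> ennreal ((c + l) + real N * l)" using N by (intro ennreal_leI) simp
      also have "\<dots> = ennreal (c + l) + ennreal (real N * l)" using c l by (intro ennreal_plus) auto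
      finally show ?thesis .
    qed
    ultimately show ?thesis by (metis add_left_mono order_trans)
  qed
  have "(\<integral>\<^sup>+\<omega>. ennreal (Z \<omega>) \<partial>M) \<le> (\<integral>\<^sup>+\<omega>. ennreal (c + l) + (\<Sum>n. ennreal l * indicator (A n) \<omega>) \<partial>M)"
    by (rule nn_integral_mono) (rule pt)
  also have "\<dots> = ennreal (c + l) + (\<Sum>n. ennreal l * emeasure M (A n))"
    by (simp add: nn_integral_add nn_integral_suminf nn_integral_cmult_indicator emeasure_space_1
        del: ennreal_suminf_cmult)
  also have "(\<Sum>n. ennreal l * emeasure M (A n)) \<le> (\<Sum>n. ennreal (l * (C * (1 / real (Suc n) ^ 4))))"
  proof (rule suminf_le)
    fix n
    show "ennreal l * emeasure M (A n) \<le> ennreal (l * (C * (1 / real (Suc n) ^ 4)))"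
    proof -
      have "l * prob (A n) \<le> l * (C * (1 / real (Suc n) ^ 4))"
        unfolding A_def using tail[of n] l by (intro mult_left_mono) (auto simp del: of_nat_Suc)
      then show ?thesis using l unfolding emeasure_eq_measure
        by (subst ennreal_mult[symmetric]) (auto intro!: ennreal_leI)
    qed
  qed auto
  also have "\<dots> = ennreal (l * (C * (\<Sum>n. 1 / real (Suc n) ^ 4)))"
    using l C by (intro suminf_ennreal_eq sums_mult summable_sums[OF sm]) auto
  also have "ennreal (c + l) + \<dots> = ennreal b"
    using c l C s0 by (subst ennreal_plus[symmetric]) (auto simp: b_def algebra_simps)
  finally have fin: "(\<integral>\<^sup>+\<omega>. ennreal (Z \<omega>) \<partial>M) \<le> ennreal b" by (simp add: add_left_mono)
  show int: "integrable M Z"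
  proof (rule integrableI_nonneg[OF Z Z0])
    show "(\<integral>\<^sup>+\<omega>. ennreal (Z \<omega>) \<partial>M) < \<infinity>" using fin by (rule order_le_less_trans) simp
  qed
  have "0 \<le> b" using c l C s0 by (simp add: b_def)
  moreover have "ennreal (expectation Z) \<le> ennreal b"
    using fin nn_integral_eq_integral[OF int Z0] by simp
  ultimately show "expectation Z \<le> c + l * (1 + C * (\<Sum>n. 1 / real (Suc n) ^ 4))"
    by (simp add: b_def)
qed

lemma polar_radius_measurable [measurable]: "polar_radius \<in> borel_measurable borel"
  unfolding polar_radius_def[abs_def] hyp_dist_def arcosh_def by measurable

context hyperbolic_brownian_motion
begin

abbreviation R :: "real \<Rightarrow> 'a \<Rightarrow> real" where "R t \<omega> \<equiv> polar_radius (B t \<omega>)"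

lemma R_measurable: "0 \<le> t \<Longrightarrow> random_variable borel (R t)"
  using measurable_compose[OF B_measurable polar_radius_measurable] by simp

lemma AE_radial_path: "AE \<omega> in M. radial_path (\<lambda>t. R t \<omega>) (\<lambda>t. WR t \<omega>)"
  using radius_continuous radius_pos radius_sde B_start
proof eventually_elim
  case (elim \<omega>)
  then show ?case
    by unfold_locales (auto simp: coth_drift_def polar_radius_def hyp_dist_def)
qed

lemma AE_R_nonneg: "0 \<le> t \<Longrightarrow> AE \<omega> in M. 0 \<le> R t \<omega>"
  using AE_radial_path by eventually_elim (rule radial_path.nonneg)

lemma AE_WR_sublinear: "AE \<omega> in M. ((\<lambda>t. WR t \<omega> / t) \<longlongrightarrow> 0) at_top"
  by (rule bm_sublinear[OF WR_bm])

lemma AE_speed: "AE \<omega> in M. ((\<lambda>t. R t \<omega> / t) \<longlongrightarrow> 1 / 2) at_top"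
  using AE_radial_path AE_WR_sublinear by eventually_elim (rule radial_path.speed)

lemma AE_deviation_bounded:
  "AE \<omega> in M. (SUP t\<in>{0..}. ereal \<bar>R t \<omega> - WR t \<omega> - t / 2\<bar>) < \<infinity>"
  using AE_radial_path AE_WR_sublinear
proof eventually_elim
  case (elim \<omega>)
  then obtain C where "\<forall>t\<ge>0. \<bar>R t \<omega> - WR t \<omega> - t / 2\<bar> \<le> C"
    using radial_path.deviation_bounded by blast
  then have "(SUP t\<in>{0..}. ereal \<bar>R t \<omega> - WR t \<omega> - t / 2\<bar>) \<le> ereal C" by (intro SUP_least) auto
  also have "\<dots> < \<infinity>" by simp
  finally show ?case .
qed

text \<open>
  The pathwise upper bound with the level \<open>K = sqrt t\<close>: it is negligible against \<open>t\<close>, and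
  \<open>coth_drift K \<longlongrightarrow> 1/2\<close>. On the scale \<open>sqrt t\<close> the maximum of the driving motion has quartic tails with
  a constant independent of \<open>t\<close>.
\<close>

lemma R_mean_upper:
  assumes t: "0 < t"
  shows "integrable M (R t)"
    and "expectation (R t) \<le> (sqrt t + coth_drift (sqrt t) * t)
      + 2 * sqrt t * (1 + 150000 * (\<Sum>n. 1 / real (Suc n) ^ 4))"
proof -
  let ?c = "sqrt t + coth_drift (sqrt t) * t"
  have c0: "0 \<le> ?c" using t coth_drift_gt_half[of "sqrt t"] by simp
  have tail: "prob {\<omega> \<in> space M. ?c + real (Suc n) * (2 * sqrt t) < R t \<omega>} \<le> 150000 / real (Suc n) ^ 4" for n
  proof -
    define x where "x = real (Suc n) * sqrt t"
    have x: "0 < x" using t by (simp add: x_def)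
    let ?E = "{\<omega> \<in> space M. \<exists>m. \<exists>k\<le>2 ^ m. x < \<bar>WR (t * real k / 2 ^ m) \<omega> - WR 0 \<omega>\<bar>}"
    have "AE \<omega> in M. \<omega> \<in> {\<omega> \<in> space M. ?c + real (Suc n) * (2 * sqrt t) < R t \<omega>} \<longrightarrow> \<omega> \<in> ?E"
    proof -
      have "AE \<omega> in M. continuous_on {0..} (\<lambda>t. WR t \<omega>)"
        using WR_bm by (simp add: standard_brownian_motion_def)
      with AE_radial_path show ?thesis
      proof eventually_elim
        case (elim \<omega>)
        show ?case
        proof (rule impI, rule ccontr)
          assume R: "\<omega> \<in> {\<omega> \<in> space M. ?c + real (Suc n) * (2 * sqrt t) < R t \<omega>}" and nE: "\<omega> \<notin> ?E"
          have "\<bar>WR u \<omega>\<bar> \<le> x" if "0 \<le> u" "u \<le> t" for u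
            by (rule bm_sup_tail_imp[where T = t and w = "\<lambda>t. WR t \<omega>"])
              (use elim that nE R radial_path.w0[OF elim(1)] in auto)
          then have "R t \<omega> \<le> ?c + 2 * x"
            using t by (intro radial_path.upper_bound[OF elim(1)]) auto
          then show False using R by (simp add: x_def algebra_simps)
        qed
      qed
    qed
    then have "prob {\<omega> \<in> space M. ?c + real (Suc n) * (2 * sqrt t) < R t \<omega>} \<le> prob ?E"
      by (rule finite_measure_mono_AE) (rule bm_sup_tail(1)[OF WR_bm t x])
    also have "\<dots> \<le> 150000 * t\<^sup>2 / x ^ 4" by (rule bm_sup_tail(2)[OF WR_bm t x])
    also have "x ^ 4 = real (Suc n) ^ 4 * t\<^sup>2"
    proof -
      have "sqrt t ^ (2 * 2) = t\<^sup>2" unfolding power_mult using t by simp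
      then show ?thesis by (simp add: x_def power_mult_distrib)
    qed
    finally show ?thesis using t by (simp del: of_nat_Suc)
  qed
  note * = quartic_tail_expectation[OF R_measurable[of t] AE_R_nonneg[of t] c0 _ _ tail]
  show "integrable M (R t)" by (rule *(1)) (use t in auto)
  show "expectation (R t) \<le> ?c + 2 * sqrt t * (1 + 150000 * (\<Sum>n. 1 / real (Suc n) ^ 4))"
    by (rule *(2)) (use t in auto)
qed

lemma R_integrable: assumes "0 \<le> t" shows "integrable M (R t)"
proof (cases "t = 0")
  case True
  have "AE \<omega> in M. R 0 \<omega> = 0"
    using AE_radial_path by eventually_elim (rule radial_path.zero)
  then have "integrable M (R 0) \<longleftrightarrow> integrable M (\<lambda>_. 0 :: real)"
    by (intro integrable_cong_AE R_measurable) auto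
  then show ?thesis using True by simp
qed (use assms R_mean_upper in auto)

lemma R_mean_lower:
  assumes t: "0 < t" shows "t / 2 \<le> expectation (R t)"
proof -
  have N: "distributed M lborel (\<lambda>\<omega>. WR t \<omega> - WR 0 \<omega>) (normal_density 0 (sqrt t))"
    using bm_increment[OF WR_bm, of 0 t] t by simp
  have int: "integrable M (\<lambda>\<omega>. WR t \<omega> - WR 0 \<omega>)"
    using distributed_integrable[OF N, of "\<lambda>x. x"] integrable_normal_moment_nz_1[of "sqrt t" 0] t by simp
  have "expectation (\<lambda>\<omega>. t / 2 + (WR t \<omega> - WR 0 \<omega>)) = t / 2"
    using normal_distributed_expectation[OF _ N] t int by (simp add: prob_space)
  moreover have "expectation (\<lambda>\<omega>. t / 2 + (WR t \<omega> - WR 0 \<omega>)) \<le> expectation (R t)"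
  proof (rule integral_mono_AE)
    show "AE \<omega> in M. t / 2 + (WR t \<omega> - WR 0 \<omega>) \<le> R t \<omega>"
      using AE_radial_path
    proof eventually_elim
      case (elim \<omega>)
      then show ?case using radial_path.lower_bound[OF elim, of t] radial_path.w0[OF elim] t by simp
    qed
  qed (use int R_integrable t in auto)
  ultimately show ?thesis by simp
qed

lemma mean_speed: "((\<lambda>t. expectation (R t) / t) \<longlongrightarrow> 1 / 2) at_top"
proof -
  define K where "K = 1 + 2 * (1 + 150000 * (\<Sum>n. 1 / real (Suc n) ^ 4))"
  have inv: "((\<lambda>t. 1 / sqrt t) \<longlongrightarrow> 0) at_top"
    by (rule tendsto_divide_0[OF tendsto_const filterlim_at_top_imp_at_infinity[OF sqrt_at_top]])
  have "((\<lambda>t. coth_drift (sqrt t) + K * (1 / sqrt t)) \<longlongrightarrow> 1 / 2 + K * 0) at_top"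
    by (intro tendsto_intros inv filterlim_compose[OF coth_drift_tendsto sqrt_at_top])
  then have up: "((\<lambda>t. coth_drift (sqrt t) + K * (1 / sqrt t)) \<longlongrightarrow> 1 / 2) at_top" by simp
  show ?thesis
  proof (rule real_tendsto_sandwich[OF _ _ tendsto_const up])
    show "\<forall>\<^sub>F t in at_top. 1 / 2 \<le> expectation (R t) / t"
      using eventually_gt_at_top[of 0]
    proof eventually_elim
      case (elim t)
      then show ?case using R_mean_lower[of t] by (simp add: field_simps)
    qed
    show "\<forall>\<^sub>F t in at_top. expectation (R t) / t \<le> coth_drift (sqrt t) + K * (1 / sqrt t)"
      using eventually_gt_at_top[of 0]
    proof eventually_elim
      case (elim t)
      have "expectation (R t) \<le> coth_drift (sqrt t) * t + K * sqrt t"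
        using R_mean_upper(2)[OF elim] by (simp add: K_def algebra_simps)
      then have "expectation (R t) / t \<le> (coth_drift (sqrt t) * t + K * sqrt t) / t"
        using elim by (intro divide_right_mono) auto
      also have "\<dots> = coth_drift (sqrt t) + K * (1 / sqrt t)"
      proof -
        have "sqrt t / t = 1 / sqrt t"
          using elim real_sqrt_mult_self[of t] by (simp add: frac_eq_eq del: real_sqrt_mult_self)
        then have "K * sqrt t / t = K * (1 / sqrt t)" by (metis times_divide_eq_right)
        then show ?thesis using elim by (simp add: add_divide_distrib)
      qed
      finally show ?case .
    qed
  qed
qed

end

section \<open>Normal sums with independent random weights\<close>

text \<open>
  Fubini: a bound that holds for every frozen value of \<open>Y\<close> holds on average over an independent \<open>Y\<close>.
\<close>

lemma (in prob_space) prob_freeze_second: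
  assumes indep: "indep_var N1 X N2 Y" and E: "E \<in> sets (N1 \<Otimes>\<^sub>M N2)"
    and le: "\<And>y. y \<in> space N2 \<Longrightarrow> prob {\<omega> \<in> space M. (X \<omega>, y) \<in> E} \<le> c"
  shows "prob {\<omega> \<in> space M. (X \<omega>, Y \<omega>) \<in> E} \<le> c"
proof -
  from indep have X [measurable]: "random_variable N1 X" and Y [measurable]: "random_variable N2 Y"
    and D: "distr M N1 X \<Otimes>\<^sub>M distr M N2 Y = distr M (N1 \<Otimes>\<^sub>M N2) (\<lambda>\<omega>. (X \<omega>, Y \<omega>))"
    by (auto simp: indep_var_distribution_eq)
  interpret D1: prob_space "distr M N1 X" by (rule prob_space_distr) (rule X)
  interpret D2: prob_space "distr M N2 Y" by (rule prob_space_distr) (rule Y)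
  interpret D: pair_prob_space "distr M N1 X" "distr M N2 Y" ..
  obtain y where "y \<in> space N2" using measurable_space[OF Y] not_empty by blast
  then have c: "0 \<le> c" using le[of y] by (auto intro: order_trans[OF measure_nonneg])
  have E': "E \<in> sets (distr M N1 X \<Otimes>\<^sub>M distr M N2 Y)"
    using E by (subst sets_pair_measure_cong[of _ N1 _ N2]) auto
  have sec: "(\<lambda>x. (x, y)) -` E \<in> sets N1" for y by (rule sets_Pair2[OF E])
  have "emeasure M {\<omega> \<in> space M. (X \<omega>, Y \<omega>) \<in> E} = emeasure (distr M (N1 \<Otimes>\<^sub>M N2) (\<lambda>\<omega>. (X \<omega>, Y \<omega>))) E"
    by (subst emeasure_distr) (auto simp: E intro!: arg_cong[where f = "emeasure M"])
  also have "\<dots> = (\<integral>\<^sup>+y. emeasure (distr M N1 X) ((\<lambda>x. (x, y)) -` E) \<partial>distr M N2 Y)"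
    unfolding D[symmetric] by (rule D.emeasure_pair_measure_alt2[OF E'])
  also have "\<dots> \<le> (\<integral>\<^sup>+y. ennreal c \<partial>distr M N2 Y)"
  proof (rule nn_integral_mono)
    fix y assume "y \<in> space (distr M N2 Y)"
    then have "prob {\<omega> \<in> space M. (X \<omega>, y) \<in> E} \<le> c" by (intro le) simp
    moreover have "X -` ((\<lambda>x. (x, y)) -` E) \<inter> space M = {\<omega> \<in> space M. (X \<omega>, y) \<in> E}" by auto
    ultimately show "emeasure (distr M N1 X) ((\<lambda>x. (x, y)) -` E) \<le> ennreal c"
      by (simp add: emeasure_distr[OF X sec] emeasure_eq_measure ennreal_leI)
  qed
  also have "\<dots> = ennreal c" using D2.emeasure_space_1 by simp
  finally show ?thesis using c by (simp add: emeasure_eq_measure)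
qed

context prob_space begin

lemma bm_weighted_increments:
  assumes V: "standard_brownian_motion V" and a: "0 \<le> a" and h: "0 < h" and n: "0 < n"
    and c: "\<And>i. i < n \<Longrightarrow> 0 < c i"
  shows "distributed M lborel
      (\<lambda>\<omega>. \<Sum>i<n. c i * (V (a + real (Suc i) * h) \<omega> - V (a + real i * h) \<omega>))
      (normal_density 0 (sqrt (\<Sum>i<n. (c i)\<^sup>2 * h)))"
proof -
  define \<tau> where "\<tau> = (\<lambda>i. a + real i * h)"
  have step: "\<tau> (Suc i) = \<tau> i + h" for i by (simp add: \<tau>_def algebra_simps)
  have \<tau>: "0 \<le> \<tau> i" "\<tau> i < \<tau> (Suc i)" "\<tau> (Suc i) - \<tau> i = h" for i
    using a h unfolding step by (simp_all add: \<tau>_def)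
  have "\<forall>(n::nat) \<tau>. 0 \<le> \<tau> 0 \<and> (\<forall>i<n. \<tau> i \<le> \<tau> (Suc i)) \<longrightarrow>
        indep_vars (\<lambda>_. borel) (\<lambda>i \<omega>. V (\<tau> (Suc i)) \<omega> - V (\<tau> i) \<omega>) {..<n}"
    using V unfolding standard_brownian_motion_def by blast
  then have ind: "indep_vars (\<lambda>_. borel) (\<lambda>i \<omega>. V (\<tau> (Suc i)) \<omega> - V (\<tau> i) \<omega>) {..<n}"
    using \<tau>(1)[of 0] less_imp_le[OF \<tau>(2)] by (simp del: of_nat_Suc)
  have ind': "indep_vars (\<lambda>_. borel) (\<lambda>i \<omega>. c i * (V (\<tau> (Suc i)) \<omega> - V (\<tau> i) \<omega>)) {..<n}"
    by (rule indep_vars_compose2[OF ind]) measurable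
  have nd: "distributed M lborel (\<lambda>\<omega>. c i * (V (\<tau> (Suc i)) \<omega> - V (\<tau> i) \<omega>)) (normal_density 0 (c i * sqrt h))"
    if "i < n" for i
  proof -
    have "distributed M lborel (\<lambda>\<omega>. V (\<tau> (Suc i)) \<omega> - V (\<tau> i) \<omega>) (normal_density 0 (sqrt h))"
      using bm_increment[OF V \<tau>(1) \<tau>(2), of i] \<tau>(3) by simp
    from normal_density_affine[OF this, of "c i" 0] show ?thesis
      using c[OF that] h by simp
  qed
  have "distributed M lborel (\<lambda>\<omega>. \<Sum>i<n. c i * (V (\<tau> (Suc i)) \<omega> - V (\<tau> i) \<omega>))
      (normal_density (\<Sum>i<n. 0) (sqrt (\<Sum>i<n. (c i * sqrt h)\<^sup>2)))"
    by (rule sum_indep_normal[OF _ _ ind']) (use n c h nd in auto)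
  then show ?thesis using h by (simp add: \<tau>_def power_mult_distrib)
qed

text \<open>
  Once the weights are frozen, the sum is centred normal with variance between \<open>lo\<^sup>2 n h\<close> and \<open>hi\<^sup>2 n h\<close>.
  The upper bound controls the fourth moment, the lower bound the small ball probability.
\<close>

lemma independent_weights_tails:
  fixes g :: "nat \<Rightarrow> (real \<Rightarrow> real) \<Rightarrow> real"
  assumes V: "standard_brownian_motion V" and ind: "indep_processes V U"
    and a: "0 \<le> a" and h: "0 < h" and n: "0 < n" and lo: "0 < lo"
    and g: "\<And>i. i < n \<Longrightarrow> g i \<in> borel_measurable path_space"
    and g_bounds: "\<And>i u. i < n \<Longrightarrow> lo \<le> g i u \<and> g i u \<le> hi"
  defines "S \<equiv> \<lambda>\<omega>. \<Sum>i<n. g i (\<lambda>t\<in>{0..}. U t \<omega>) * (V (a + real (Suc i) * h) \<omega> - V (a + real i * h) \<omega>)"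
  shows "random_variable borel S"
    and "0 < x \<Longrightarrow> prob {\<omega> \<in> space M. x < \<bar>S \<omega>\<bar>} \<le> 3 * (hi\<^sup>2 * (real n * h))\<^sup>2 / x ^ 4"
    and "0 \<le> y \<Longrightarrow> prob {\<omega> \<in> space M. \<bar>S \<omega>\<bar> \<le> y} \<le> y / (lo * sqrt (real n * h))"
proof -
  define T where "T = (\<lambda>(v::real \<Rightarrow> real, u). \<Sum>i<n. g i u * (v (a + real (Suc i) * h) - v (a + real i * h)))"
  have ind': "indep_var path_space (\<lambda>\<omega>. \<lambda>t\<in>{0..}. V t \<omega>) path_space (\<lambda>\<omega>. \<lambda>t\<in>{0..}. U t \<omega>)"
    using ind by (simp add: indep_processes_def)
  then have [measurable]: "random_variable path_space (\<lambda>\<omega>. \<lambda>t\<in>{0..}. V t \<omega>)"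
      "random_variable path_space (\<lambda>\<omega>. \<lambda>t\<in>{0..}. U t \<omega>)"
    by (auto simp: indep_var_distribution_eq)
  have ge0: "0 \<le> a + real i * h" for i using a h by simp
  have T [measurable]: "T \<in> borel_measurable (path_space \<Otimes>\<^sub>M path_space)"
    unfolding T_def split_beta'
  proof (intro borel_measurable_sum borel_measurable_times borel_measurable_diff)
    fix i assume "i \<in> {..<n}"
    then show "(\<lambda>x. g i (snd x)) \<in> borel_measurable (path_space \<Otimes>\<^sub>M path_space)"
      using measurable_compose[OF measurable_snd g] by auto
    have "(\<lambda>v. v (a + real i * h)) \<in> borel_measurable path_space" for i
      by (rule measurable_component_singleton) (use ge0 in auto)
    from measurable_compose[OF measurable_fst this]
    show "(\<lambda>x. fst x (a + real (Suc i) * h)) \<in> borel_measurable (path_space \<Otimes>\<^sub>M path_space)"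
      "(\<lambda>x. fst x (a + real i * h)) \<in> borel_measurable (path_space \<Otimes>\<^sub>M path_space)"
      by blast+
  qed
  have ST: "S \<omega> = T (\<lambda>t\<in>{0..}. V t \<omega>, \<lambda>t\<in>{0..}. U t \<omega>)" for \<omega>
    unfolding S_def T_def using ge0 by (simp del: of_nat_Suc)
  show "random_variable borel S" unfolding ST[abs_def] by measurable
  have law: "distributed M lborel (\<lambda>\<omega>. T (\<lambda>t\<in>{0..}. V t \<omega>, u)) (normal_density 0 (sqrt (\<Sum>i<n. (g i u)\<^sup>2 * h)))" for u
  proof -
    have "0 < g i u" if "i < n" for i using g_bounds[OF that, of u] lo by linarith
    then have "distributed M lborel (\<lambda>\<omega>. \<Sum>i<n. g i u * (V (a + real (Suc i) * h) \<omega> - V (a + real i * h) \<omega>))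
      (normal_density 0 (sqrt (\<Sum>i<n. (g i u)\<^sup>2 * h)))"
      by (intro bm_weighted_increments[OF V a h n])
    moreover have "(\<lambda>\<omega>. T (\<lambda>t\<in>{0..}. V t \<omega>, u)) = (\<lambda>\<omega>. \<Sum>i<n. g i u * (V (a + real (Suc i) * h) \<omega> - V (a + real i * h) \<omega>))"
      unfolding T_def using ge0 by (simp del: of_nat_Suc)
    ultimately show ?thesis by simp
  qed
  have var: "real n * (lo\<^sup>2 * h) \<le> (\<Sum>i<n. (g i u)\<^sup>2 * h)" "(\<Sum>i<n. (g i u)\<^sup>2 * h) \<le> real n * (hi\<^sup>2 * h)" for u
  proof -
    have "(\<Sum>i<n. lo\<^sup>2 * h) \<le> (\<Sum>i<n. (g i u)\<^sup>2 * h)"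
      using g_bounds lo h by (intro sum_mono mult_right_mono power_mono) auto
    then show "real n * (lo\<^sup>2 * h) \<le> (\<Sum>i<n. (g i u)\<^sup>2 * h)" by simp
    have "(\<Sum>i<n. (g i u)\<^sup>2 * h) \<le> (\<Sum>i<n. hi\<^sup>2 * h)"
      using g_bounds lo h by (intro sum_mono mult_right_mono power_mono) (auto intro: order_trans[OF less_imp_le])
    then show "(\<Sum>i<n. (g i u)\<^sup>2 * h) \<le> real n * (hi\<^sup>2 * h)" by simp
  qed
  have v0: "0 < real n * (lo\<^sup>2 * h)" using n lo h by simp
  show "prob {\<omega> \<in> space M. x < \<bar>S \<omega>\<bar>} \<le> 3 * (hi\<^sup>2 * (real n * h))\<^sup>2 / x ^ 4" if x: "0 < x"
  proof -
    let ?E = "{z \<in> space (path_space \<Otimes>\<^sub>M path_space). x < \<bar>T z\<bar>}"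
    have "prob {\<omega> \<in> space M. (\<lambda>t\<in>{0..}. V t \<omega>, \<lambda>t\<in>{0..}. U t \<omega>) \<in> ?E} \<le> 3 * (hi\<^sup>2 * (real n * h))\<^sup>2 / x ^ 4"
    proof (rule prob_freeze_second[OF ind'])
      show "?E \<in> sets (path_space \<Otimes>\<^sub>M path_space)" by measurable
      fix u :: "real \<Rightarrow> real" assume u: "u \<in> space path_space"
      let ?v = "\<Sum>i<n. (g i u)\<^sup>2 * h"
      have "prob {\<omega> \<in> space M. (\<lambda>t\<in>{0..}. V t \<omega>, u) \<in> ?E} = prob {\<omega> \<in> space M. x < \<bar>T (\<lambda>t\<in>{0..}. V t \<omega>, u)\<bar>}"
        using u by (intro arg_cong[where f = prob]) (auto simp: space_pair_measure space_PiM)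
      also have "\<dots> \<le> 3 * sqrt ?v ^ 4 / x ^ 4"
        by (rule normal_tail_fourth_moment[OF law _ x]) (use var(1)[of u] v0 in auto)
      also have "sqrt ?v ^ 4 = ?v\<^sup>2"
        using var(1)[of u] v0 power_mult[of "sqrt ?v" 2 2] by simp
      also have "3 * ?v\<^sup>2 / x ^ 4 \<le> 3 * (hi\<^sup>2 * (real n * h))\<^sup>2 / x ^ 4"
        using var[of u] v0 x
        by (intro divide_right_mono mult_left_mono power_mono) (auto simp: mult_ac)
      finally show "prob {\<omega> \<in> space M. (\<lambda>t\<in>{0..}. V t \<omega>, u) \<in> ?E} \<le> 3 * (hi\<^sup>2 * (real n * h))\<^sup>2 / x ^ 4" .
    qed
    moreover have "{\<omega> \<in> space M. (\<lambda>t\<in>{0..}. V t \<omega>, \<lambda>t\<in>{0..}. U t \<omega>) \<in> ?E} = {\<omega> \<in> space M. x < \<bar>S \<omega>\<bar>}"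
      by (auto simp: ST space_pair_measure space_PiM)
    ultimately show ?thesis by simp
  qed
  show "prob {\<omega> \<in> space M. \<bar>S \<omega>\<bar> \<le> y} \<le> y / (lo * sqrt (real n * h))" if y: "0 \<le> y"
  proof -
    let ?E = "{z \<in> space (path_space \<Otimes>\<^sub>M path_space). \<bar>T z\<bar> \<le> y}"
    have "prob {\<omega> \<in> space M. (\<lambda>t\<in>{0..}. V t \<omega>, \<lambda>t\<in>{0..}. U t \<omega>) \<in> ?E} \<le> y / (lo * sqrt (real n * h))"
    proof (rule prob_freeze_second[OF ind'])
      show "?E \<in> sets (path_space \<Otimes>\<^sub>M path_space)" by measurable
      fix u :: "real \<Rightarrow> real" assume u: "u \<in> space path_space"
      let ?v = "\<Sum>i<n. (g i u)\<^sup>2 * h"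
      have "prob {\<omega> \<in> space M. (\<lambda>t\<in>{0..}. V t \<omega>, u) \<in> ?E} = prob {\<omega> \<in> space M. \<bar>T (\<lambda>t\<in>{0..}. V t \<omega>, u)\<bar> \<le> y}"
        using u by (intro arg_cong[where f = prob]) (auto simp: space_pair_measure space_PiM)
      also have "\<dots> \<le> y / sqrt ?v"
        by (rule normal_small_ball[OF law _ y]) (use var(1)[of u] v0 in auto)
      also have "\<dots> \<le> y / sqrt (real n * (lo\<^sup>2 * h))"
        using var(1)[of u] v0 y by (intro divide_left_mono mult_pos_pos) auto
      also have "sqrt (real n * (lo\<^sup>2 * h)) = lo * sqrt (real n * h)"
        using lo by (simp add: real_sqrt_mult mult_ac)
      finally show "prob {\<omega> \<in> space M. (\<lambda>t\<in>{0..}. V t \<omega>, u) \<in> ?E} \<le> y / (lo * sqrt (real n * h))" .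
    qed
    moreover have "{\<omega> \<in> space M. (\<lambda>t\<in>{0..}. V t \<omega>, \<lambda>t\<in>{0..}. U t \<omega>) \<in> ?E} = {\<omega> \<in> space M. \<bar>S \<omega>\<bar> \<le> y}"
      by (auto simp: ST space_pair_measure space_PiM)
    ultimately show ?thesis by simp
  qed
qed

end

section \<open>Increments of the winding process\<close>

context hyperbolic_brownian_motion
begin

lemma AE_R_functional: "0 < t \<Longrightarrow> AE \<omega> in M. radial_functional t (\<lambda>u\<in>{0..}. WR u \<omega>) = R t \<omega>"
  using AE_radial_path
  by eventually_elim (auto intro!: radial_path.radial_functional_eq radial_path.restrict_path)

lemma \<Theta>_measurable: "0 < s \<Longrightarrow> s \<le> t \<Longrightarrow> random_variable borel (\<Theta> s t)"
  using winding_sde[of s] by (simp add: ito_integral_from_def)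

abbreviation winding_sum :: "real \<Rightarrow> nat \<Rightarrow> nat set \<Rightarrow> 'a \<Rightarrow> real" where
  "winding_sum s m I \<omega> \<equiv> \<Sum>i\<in>I. 1 / sinh (R (s + real i / 2 ^ m) \<omega>) *
      (W s (s + real (Suc i) / 2 ^ m) \<omega> - W s (s + real i / 2 ^ m) \<omega>)"

text \<open>
  Each dyadic partition of level \<open>m + l\<close> contains the time \<open>j / 2\<^sup>m\<close>, so sums over the same partition
  approximate the integral at both ends of a dyadic interval.
\<close>

lemma winding_sum_converges:
  assumes s: "0 < s" and e: "0 < e"
  shows "\<forall>\<^sub>F l in sequentially.
    prob {\<omega> \<in> space M. e < \<bar>winding_sum s (m + l) {..<j * 2 ^ l} \<omega> - \<Theta> s (s + real j / 2 ^ m) \<omega>\<bar>} < e"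
proof -
  let ?t = "s + real j / 2 ^ m"
  have "s \<le> ?t" by simp
  from winding_sde[OF s, unfolded ito_integral_from_def, THEN conjunct2, THEN conjunct2, THEN conjunct2,
      THEN spec, THEN mp, OF this, THEN spec, THEN mp, OF e]
  obtain d where d: "0 < d" and D: "\<forall>(n::nat) \<tau>. \<tau> 0 = s \<and> \<tau> n = ?t \<and> (\<forall>i<n. \<tau> i \<le> \<tau> (Suc i) \<and> \<tau> (Suc i) - \<tau> i < d) \<longrightarrow>
        prob {\<omega> \<in> space M.
          \<bar>(\<Sum>i<n. 1 / sinh (R (\<tau> i) \<omega>) * (W s (\<tau> (Suc i)) \<omega> - W s (\<tau> i) \<omega>)) - \<Theta> s ?t \<omega>\<bar> > e} < e"
    by (elim exE conjE) (rule that)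
  have "(\<lambda>l. (1 / 2) ^ m * (1 / 2) ^ l) \<longlonglongrightarrow> (1 / 2 :: real) ^ m * 0"
    by (intro tendsto_intros LIMSEQ_power_zero) simp
  then have "\<forall>\<^sub>F l in sequentially. (1 / 2) ^ m * (1 / 2) ^ l < d"
    using d by (intro order_tendstoD(2)[where y = 0]) auto
  then show ?thesis
  proof eventually_elim
    case (elim l)
    have "prob {\<omega> \<in> space M. \<bar>winding_sum s (m + l) {..<j * 2 ^ l} \<omega> - \<Theta> s ?t \<omega>\<bar> > e} < e"
    proof (rule D[THEN spec, THEN spec, THEN mp, of "\<lambda>i. s + real i / 2 ^ (m + l)" "j * 2 ^ l"], intro conjI allI impI)
      show "s + real (j * 2 ^ l) / 2 ^ (m + l) = ?t" by (simp add: power_add)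
      show "s + real (Suc i) / 2 ^ (m + l) - (s + real i / 2 ^ (m + l)) < d" for i
        using elim by (simp add: power_add power_divide add_divide_distrib)
    qed (auto intro: divide_right_mono)
    then show ?case .
  qed
qed

text \<open>
  The tails of a normal variable with variance between \<open>lo\<^sup>2 t\<close> and \<open>hi\<^sup>2 t\<close> pass to the stochastic
  integral. The bounds on the integrand hold only on \<open>A\<close>, which need not be determined by the radial
  path; clamping makes them hold everywhere without changing the sum on \<open>A\<close>.
\<close>

lemma winding_increment_tails:
  assumes s: "0 < s" and A: "A \<in> events" and jk: "j < k" and lo: "0 < lo"
    and H: "\<And>\<omega> l i. \<omega> \<in> A \<Longrightarrow> j * 2 ^ l \<le> i \<Longrightarrow> i < k * 2 ^ l \<Longrightarrow>
      lo \<le> 1 / sinh (R (s + real i / 2 ^ (m + l)) \<omega>) \<and> 1 / sinh (R (s + real i / 2 ^ (m + l)) \<omega>) \<le> hi"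
    and lohi: "lo \<le> hi"
  defines "D \<equiv> \<lambda>\<omega>. \<Theta> s (s + real k / 2 ^ m) \<omega> - \<Theta> s (s + real j / 2 ^ m) \<omega>"
    and "t \<equiv> real (k - j) / 2 ^ m"
  shows "0 < x \<Longrightarrow> prob {\<omega> \<in> A. x < \<bar>D \<omega>\<bar>} \<le> 3 * (hi\<^sup>2 * t)\<^sup>2 / x ^ 4"
    and "0 \<le> y \<Longrightarrow> prob {\<omega> \<in> A. \<bar>D \<omega>\<bar> \<le> y} \<le> y / (lo * sqrt t)"
proof -
  have t0: "0 < t" using jk by (simp add: t_def)
  have AS: "A \<subseteq> space M" using A by (rule sets.sets_into_space)
  have [measurable]: "random_variable borel (\<Theta> s (s + real i / 2 ^ m))" for i
    using s by (intro \<Theta>_measurable) auto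
  note [measurable] = A
  have eqS: "{\<omega> \<in> A. P \<omega>} = A \<inter> {\<omega> \<in> space M. P \<omega>}" for P using AS by auto
  have D [measurable]: "random_variable borel D" unfolding D_def by measurable
  have approx: "\<exists>S. random_variable borel S
      \<and> (\<forall>x>0. prob {\<omega> \<in> space M. x < \<bar>S \<omega>\<bar>} \<le> 3 * (hi\<^sup>2 * t)\<^sup>2 / x ^ 4)
      \<and> (\<forall>y\<ge>0. prob {\<omega> \<in> space M. \<bar>S \<omega>\<bar> \<le> y} \<le> y / (lo * sqrt t))
      \<and> prob {\<omega> \<in> A. 2 * e < \<bar>S \<omega> - D \<omega>\<bar>} \<le> 2 * e" if e: "0 < e" for e
  proof -
    let ?E = "\<lambda>l j. {\<omega> \<in> space M. e < \<bar>winding_sum s (m + l) {..<j * 2 ^ l} \<omega> - \<Theta> s (s + real j / 2 ^ m) \<omega>\<bar>}"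
    have "\<forall>\<^sub>F l in sequentially. prob (?E l j) < e \<and> prob (?E l k) < e"
      by (intro eventually_conj winding_sum_converges s e)
    then obtain l where l: "prob (?E l j) < e" "prob (?E l k) < e"
      by (auto simp: eventually_sequentially)
    define h where "h = 1 / (2::real) ^ (m + l)"
    define n where "n = (k - j) * 2 ^ l"
    define a where "a = real (j * 2 ^ l) * h"
    define V where "V = (\<lambda>u \<omega>. W s (s + u) \<omega> - W s s \<omega>)"
    \<comment> \<open>The clamped integrand as a function of the driving path of the radius.\<close>
    define g where "g = (\<lambda>i w. max lo (min hi (1 / sinh (radial_functional (s + (a + real i * h)) w))))"
    define S where "S = (\<lambda>\<omega>. \<Sum>i<n. g i (\<lambda>t\<in>{0..}. WR t \<omega>) * (V (a + real (Suc i) * h) \<omega> - V (a + real i * h) \<omega>))"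
    have h: "0 < h" and a: "0 \<le> a" and n: "0 < n" using jk by (auto simp: h_def a_def n_def)
    have nh: "real n * h = t" using jk by (simp add: n_def h_def t_def power_add)
    have ai: "a + real i * h = real (j * 2 ^ l + i) / 2 ^ (m + l)" for i
      by (simp add: a_def h_def add_divide_distrib)
    have gm: "g i \<in> borel_measurable path_space" for i
    proof -
      have [measurable]: "radial_functional (s + (a + real i * h)) \<in> borel_measurable path_space"
        using s a h by (intro radial_functional_measurable) (simp add: add_pos_nonneg)
      have [measurable]: "(sinh :: real \<Rightarrow> real) \<in> borel_measurable borel"
        by (intro borel_measurable_continuous_onI continuous_intros)
      show ?thesis unfolding g_def by measurable
    qed
    have gb: "lo \<le> g i w \<and> g i w \<le> hi" for i w using lohi by (simp add: g_def)
    have V: "standard_brownian_motion V" unfolding V_def by (rule W_bm[OF s])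
    have VWR: "indep_processes V WR" unfolding V_def by (rule W_indep[OF s])
    have S_apply: "S \<omega> = (\<Sum>i<n. g i (\<lambda>t\<in>{0..}. WR t \<omega>) * (V (a + real (Suc i) * h) \<omega> - V (a + real i * h) \<omega>))" for \<omega>
      by (simp add: S_def)
    note tails = independent_weights_tails[where g = g, OF V VWR a h n lo gm gb, folded S_apply, unfolded nh]
    have "AE \<omega> in M. \<forall>i. radial_functional (s + (a + real i * h)) (\<lambda>u\<in>{0..}. WR u \<omega>) = R (s + (a + real i * h)) \<omega>"
      using s a h by (intro AE_all_countable[THEN iffD2] allI AE_R_functional) (simp add: add_pos_nonneg)
    then have AES: "AE \<omega> in M. \<omega> \<in> A \<longrightarrow> S \<omega> = winding_sum s (m + l) {..<k * 2 ^ l} \<omega> - winding_sum s (m + l) {..<j * 2 ^ l} \<omega>"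
    proof eventually_elim
      case (elim \<omega>)
      show ?case
      proof
        assume w: "\<omega> \<in> A"
        have kn: "k * 2 ^ l = j * 2 ^ l + n" using jk by (simp add: n_def algebra_simps)
        let ?f = "\<lambda>i. 1 / sinh (R (s + real i / 2 ^ (m + l)) \<omega>) *
          (W s (s + real (Suc i) / 2 ^ (m + l)) \<omega> - W s (s + real i / 2 ^ (m + l)) \<omega>)"
        have "S \<omega> = (\<Sum>i<n. ?f (j * 2 ^ l + i))"
          unfolding S_def
        proof (rule sum.cong[OF refl])
          fix i assume i: "i \<in> {..<n}"
          have "g i (\<lambda>t\<in>{0..}. WR t \<omega>) = 1 / sinh (R (s + real (j * 2 ^ l + i) / 2 ^ (m + l)) \<omega>)"
            unfolding g_def ai elim[rule_format, of i, unfolded ai] using H[OF w, of l "j * 2 ^ l + i"] i kn by auto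
          then show "g i (\<lambda>t\<in>{0..}. WR t \<omega>) * (V (a + real (Suc i) * h) \<omega> - V (a + real i * h) \<omega>) = ?f (j * 2 ^ l + i)"
            unfolding V_def ai by simp
        qed
        also have "\<dots> = sum ?f {j * 2 ^ l..<k * 2 ^ l}"
          using sum.shift_bounds_nat_ivl[of ?f 0 "j * 2 ^ l" n] by (simp add: kn lessThan_atLeast0 add_ac)
        also have "\<dots> = sum ?f {..<k * 2 ^ l} - sum ?f {..<j * 2 ^ l}"
          using jk by (subst sum_diff_nat_ivl[symmetric, of 0]) (auto simp: lessThan_atLeast0)
        finally show "S \<omega> = winding_sum s (m + l) {..<k * 2 ^ l} \<omega> - winding_sum s (m + l) {..<j * 2 ^ l} \<omega>" .
      qed
    qed
    have wm [measurable]: "random_variable borel (winding_sum s (m + l) I)" for I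
    proof (intro borel_measurable_sum borel_measurable_times)
      fix i :: nat
      have [measurable]: "random_variable borel (R (s + real i / 2 ^ (m + l)))"
        using s by (intro R_measurable) simp
      have [measurable]: "(sinh :: real \<Rightarrow> real) \<in> borel_measurable borel"
        by (intro borel_measurable_continuous_onI continuous_intros)
      show "random_variable borel (\<lambda>\<omega>. 1 / sinh (R (s + real i / 2 ^ (m + l)) \<omega>))" by measurable
      have [measurable]: "random_variable borel (V (real i / 2 ^ (m + l)))" for i
        by (intro bm_measurable[OF V]) simp
      have "random_variable borel (\<lambda>\<omega>. V (real (Suc i) / 2 ^ (m + l)) \<omega> - V (real i / 2 ^ (m + l)) \<omega>)"
        by measurable
      then show "random_variable borel (\<lambda>\<omega>. W s (s + real (Suc i) / 2 ^ (m + l)) \<omega> - W s (s + real i / 2 ^ (m + l)) \<omega>)"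
        by (simp add: V_def)
    qed
    have "prob {\<omega> \<in> A. 2 * e < \<bar>S \<omega> - D \<omega>\<bar>} \<le> prob (?E l j \<union> ?E l k)"
    proof (rule finite_measure_mono_AE)
      show "AE \<omega> in M. \<omega> \<in> {\<omega> \<in> A. 2 * e < \<bar>S \<omega> - D \<omega>\<bar>} \<longrightarrow> \<omega> \<in> ?E l j \<union> ?E l k"
        using AES
      proof eventually_elim
        case (elim \<omega>)
        then show ?case using AS unfolding D_def by fastforce
      qed
      show "?E l j \<union> ?E l k \<in> events" by measurable
    qed
    also have "\<dots> \<le> prob (?E l j) + prob (?E l k)"
      by (rule measure_Un_le) measurable
    finally have "prob {\<omega> \<in> A. 2 * e < \<bar>S \<omega> - D \<omega>\<bar>} \<le> 2 * e" using l by linarith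
    with tails(1) tails(2) tails(3) show ?thesis by (intro exI[of _ S]) simp
  qed
  \<comment> \<open>Both bounds follow by letting the error \<open>e\<close> of the approximating sum tend to zero.\<close>
  show "prob {\<omega> \<in> A. x < \<bar>D \<omega>\<bar>} \<le> 3 * (hi\<^sup>2 * t)\<^sup>2 / x ^ 4" if x: "0 < x"
  proof (rule tendsto_lowerbound)
    have x2: "0 < x / 2" using x by simp
    have "((\<lambda>e. 3 * (hi\<^sup>2 * t)\<^sup>2 / (x - 2 * e) ^ 4 + 2 * e) \<longlongrightarrow> 3 * (hi\<^sup>2 * t)\<^sup>2 / (x - 2 * 0) ^ 4 + 2 * 0) (at_right 0)"
      using x by (intro tendsto_intros) auto
    then show "((\<lambda>e. 3 * (hi\<^sup>2 * t)\<^sup>2 / (x - 2 * e) ^ 4 + 2 * e) \<longlongrightarrow> 3 * (hi\<^sup>2 * t)\<^sup>2 / x ^ 4) (at_right 0)" by simp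
    show "\<forall>\<^sub>F e in at_right 0. prob {\<omega> \<in> A. x < \<bar>D \<omega>\<bar>} \<le> 3 * (hi\<^sup>2 * t)\<^sup>2 / (x - 2 * e) ^ 4 + 2 * e"
      using eventually_at_right_real[OF x2]
    proof eventually_elim
      case (elim e)
      obtain S where S [measurable]: "random_variable borel S"
        and S1: "\<And>x. 0 < x \<Longrightarrow> prob {\<omega> \<in> space M. x < \<bar>S \<omega>\<bar>} \<le> 3 * (hi\<^sup>2 * t)\<^sup>2 / x ^ 4"
        and S2: "prob {\<omega> \<in> A. 2 * e < \<bar>S \<omega> - D \<omega>\<bar>} \<le> 2 * e"
        using approx[of e] elim by auto
      have [measurable]: "{\<omega> \<in> A. 2 * e < \<bar>S \<omega> - D \<omega>\<bar>} \<in> events" unfolding eqS by measurable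
      have "prob {\<omega> \<in> A. x < \<bar>D \<omega>\<bar>}
          \<le> prob ({\<omega> \<in> space M. x - 2 * e < \<bar>S \<omega>\<bar>} \<union> {\<omega> \<in> A. 2 * e < \<bar>S \<omega> - D \<omega>\<bar>})"
        using AS by (intro finite_measure_mono) auto
      also have "\<dots> \<le> prob {\<omega> \<in> space M. x - 2 * e < \<bar>S \<omega>\<bar>} + prob {\<omega> \<in> A. 2 * e < \<bar>S \<omega> - D \<omega>\<bar>}"
        by (rule measure_Un_le) measurable
      finally show ?case using S1[of "x - 2 * e"] S2 elim by simp
    qed
  qed simp
  show "prob {\<omega> \<in> A. \<bar>D \<omega>\<bar> \<le> y} \<le> y / (lo * sqrt t)" if y: "0 \<le> y"
  proof (rule tendsto_lowerbound)
    have "((\<lambda>e. (y + 2 * e) / (lo * sqrt t) + 2 * e) \<longlongrightarrow> (y + 2 * 0) / (lo * sqrt t) + 2 * 0) (at_right 0)"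
      using lo t0 by (intro tendsto_intros) auto
    then show "((\<lambda>e. (y + 2 * e) / (lo * sqrt t) + 2 * e) \<longlongrightarrow> y / (lo * sqrt t)) (at_right 0)" by simp
    show "\<forall>\<^sub>F e in at_right 0. prob {\<omega> \<in> A. \<bar>D \<omega>\<bar> \<le> y} \<le> (y + 2 * e) / (lo * sqrt t) + 2 * e"
      using eventually_at_right_less[of 0]
    proof eventually_elim
      case (elim e)
      obtain S where S [measurable]: "random_variable borel S"
        and S1: "\<And>y. 0 \<le> y \<Longrightarrow> prob {\<omega> \<in> space M. \<bar>S \<omega>\<bar> \<le> y} \<le> y / (lo * sqrt t)"
        and S2: "prob {\<omega> \<in> A. 2 * e < \<bar>S \<omega> - D \<omega>\<bar>} \<le> 2 * e"
        using approx[of e] elim by auto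
      have [measurable]: "{\<omega> \<in> A. 2 * e < \<bar>S \<omega> - D \<omega>\<bar>} \<in> events" unfolding eqS by measurable
      have "prob {\<omega> \<in> A. \<bar>D \<omega>\<bar> \<le> y}
          \<le> prob ({\<omega> \<in> space M. \<bar>S \<omega>\<bar> \<le> y + 2 * e} \<union> {\<omega> \<in> A. 2 * e < \<bar>S \<omega> - D \<omega>\<bar>})"
        using AS by (intro finite_measure_mono) auto
      also have "\<dots> \<le> prob {\<omega> \<in> space M. \<bar>S \<omega>\<bar> \<le> y + 2 * e} + prob {\<omega> \<in> A. 2 * e < \<bar>S \<omega> - D \<omega>\<bar>}"
        by (rule measure_Un_le) measurable
      finally show ?case using S1[of "y + 2 * e"] S2 elim y by simp
    qed
  qed simp
qed

end

section \<open>Exponential rates and reduction modulo a period\<close>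

text \<open>
  Oscillations that decay geometrically add up to a Cauchy tail of the same order.
\<close>

lemma geometric_oscillation_limit:
  fixes f :: "real \<Rightarrow> real"
  assumes c: "0 < c"
    and osc: "\<forall>\<^sub>F n in sequentially. \<forall>t\<in>{real n..real n + 1}. \<bar>f t - f (real n)\<bar> \<le> exp (- c * real n)"
  shows "\<exists>L K. (f \<longlongrightarrow> L) at_top \<and> 0 < K \<and> (\<forall>\<^sub>F t in at_top. \<bar>L - f t\<bar> \<le> K * exp (- c * t))"
proof -
  obtain n0 where n0: "\<And>n t. n0 \<le> n \<Longrightarrow> t \<in> {real n..real n + 1} \<Longrightarrow> \<bar>f t - f (real n)\<bar> \<le> exp (- c * real n)"
    using osc unfolding eventually_sequentially by blast
  define q where "q = exp (- c)"
  have q: "0 < q" "q < 1" using c by (auto simp: q_def)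
  have eq: "exp (- c * real n) = q ^ n" for n by (simp add: q_def mult.commute flip: exp_of_nat_mult)
  define d where "d = (\<lambda>n. f (real (Suc n)) - f (real n))"
  have d: "norm (d n) \<le> q ^ n" if "n0 \<le> n" for n
    using n0[OF that, of "real (Suc n)"] unfolding eq by (simp add: d_def)
  have sd: "summable d"
    by (rule summable_comparison_test'[OF summable_geometric, of q n0]) (use d q in auto)
  define L where "L = f 0 + suminf d"
  have tail: "\<bar>L - f (real n)\<bar> \<le> q ^ n / (1 - q)" if "n0 \<le> n" for n
  proof -
    have "(\<Sum>i<n. d i) = f (real n) - f 0"
      unfolding d_def by (subst sum_lessThan_telescope) simp
    then have "L - f (real n) = (\<Sum>i. d (i + n))"
      using suminf_split_initial_segment[OF sd, of n] by (simp add: L_def)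
    also have "\<bar>\<dots>\<bar> \<le> (\<Sum>i. q ^ n * q ^ i)"
      unfolding real_norm_def[symmetric]
      by (rule norm_suminf_le) (use d that q in \<open>auto intro!: summable_mult simp: add.commute simp flip: power_add\<close>)
    also have "\<dots> = q ^ n / (1 - q)" using q by (subst suminf_mult) (auto simp: suminf_geometric)
    finally show ?thesis .
  qed
  define K where "K = (1 + 1 / (1 - q)) / q"
  have K: "0 < K" using q by (auto simp: K_def intro!: divide_pos_pos add_pos_pos)
  have rate: "\<forall>\<^sub>F t in at_top. \<bar>L - f t\<bar> \<le> K * exp (- c * t)"
    using eventually_ge_at_top[of "real n0"]
  proof eventually_elim
    case (elim t)
    define n where "n = nat \<lfloor>t\<rfloor>"
    have n: "real n \<le> t" "t \<le> real n + 1" "n0 \<le> n" using elim unfolding n_def by linarith+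
    have "\<bar>L - f t\<bar> \<le> q ^ n / (1 - q) + q ^ n"
      using tail[OF n(3)] n0[OF n(3), of t] n unfolding eq by auto
    also have "\<dots> = K * (q ^ n * q)" using q by (simp add: K_def field_simps)
    also have "q ^ n * q = exp (- c * (real n + 1))"
      unfolding eq[symmetric] by (simp add: q_def algebra_simps flip: exp_add)
    also have "K * exp (- c * (real n + 1)) \<le> K * exp (- c * t)"
      using K c n by (intro mult_left_mono) auto
    finally show ?case .
  qed
  have "((\<lambda>t. K * exp (- c * t)) \<longlongrightarrow> 0) at_top"
  proof -
    have "filterlim (\<lambda>t. - c * t) at_bot at_top"
      using c by (intro filterlim_tendsto_neg_mult_at_bot[OF tendsto_const _ filterlim_ident]) auto
    then have "((\<lambda>t. exp (- c * t)) \<longlongrightarrow> 0) at_top" by (rule filterlim_compose[OF exp_at_bot])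
    from tendsto_mult_left[OF this, of K] show ?thesis by simp
  qed
  then have "((\<lambda>t. L - f t) \<longlongrightarrow> 0) at_top"
    by (rule Lim_null_comparison[rotated]) (use rate in simp)
  then have "((\<lambda>t. L - (L - f t)) \<longlongrightarrow> L - 0) at_top" by (intro tendsto_intros)
  then show ?thesis using K rate by auto
qed

lemma frequently_le_Limsup:
  fixes f :: "'b \<Rightarrow> ereal"
  assumes "\<exists>\<^sub>F x in F. c \<le> f x" shows "c \<le> Limsup F f"
proof (rule ccontr)
  assume "\<not> c \<le> Limsup F f"
  then have "\<forall>\<^sub>F x in F. f x < c" by (intro Limsup_lessD) auto
  then have "\<forall>\<^sub>F x in F. \<not> c \<le> f x" by eventually_elim auto
  with assms show False by (simp add: frequently_def)
qed

lemma eln_rate_le: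
  assumes "0 < t" "0 \<le> x" "x \<le> exp (- c * t)"
  shows "ereal (1 / t) * eln x \<le> ereal (- c)"
proof (cases "x = 0")
  case False
  then have "0 < x" using assms by simp
  moreover from this have "ln x \<le> - c * t" using assms(3) by (metis exp_gt_zero ln_exp ln_le_cancel_iff)
  ultimately show ?thesis using assms by (simp add: eln_def field_simps)
qed (use assms in \<open>simp add: eln_def\<close>)

lemma eln_rate_ge:
  assumes "0 < t" "exp (- c * t) \<le> x"
  shows "ereal (- c) \<le> ereal (1 / t) * eln x"
proof -
  have "0 < x" using assms(2) by (rule less_le_trans[OF exp_gt_zero])
  moreover from this have "- c * t \<le> ln x" using assms(2) by (metis exp_gt_zero ln_exp ln_le_cancel_iff)
  ultimately show ?thesis using assms by (simp add: eln_def field_simps)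
qed

text \<open>
  For the lower bound: if \<open>f\<close> were too close to \<open>L\<close> at both \<open>n\<close> and \<open>n + 1\<close>, the increment between these
  times would be too small. The shift by \<open>s\<close> changes the exponential bounds only by a constant factor, which
  the slack in the exponents absorbs.
\<close>

lemma Limsup_exponential_rate:
  fixes f :: "real \<Rightarrow> real"
  assumes c: "0 < c"
    and upper: "\<And>b. 0 < b \<Longrightarrow> b < c \<Longrightarrow> \<exists>K>0. \<forall>\<^sub>F t in at_top. \<bar>L - f t\<bar> \<le> K * exp (- b * t)"
    and lower: "\<And>a. c < a \<Longrightarrow> \<forall>\<^sub>F n in sequentially. exp (- a * real n) < \<bar>f (real n + 1) - f (real n)\<bar>"
    and s: "0 \<le> s"
  shows "Limsup at_top (\<lambda>t. ereal (1 / t) * eln \<bar>L - f (t - s)\<bar>) = ereal (- c)"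
proof (rule antisym)
  have up: "Limsup at_top (\<lambda>t. ereal (1 / t) * eln \<bar>L - f (t - s)\<bar>) \<le> ereal (- b)" if b: "0 < b" "b < c" for b
  proof (rule Limsup_bounded)
    define b' where "b' = (b + c) / 2"
    have b': "0 < b'" "b' < c" "b < b'" using b by (auto simp: b'_def)
    obtain K where K: "0 < K" and le: "\<forall>\<^sub>F t in at_top. \<bar>L - f t\<bar> \<le> K * exp (- b' * t)"
      using upper[OF b'(1,2)] by blast
    have "filterlim (\<lambda>t. - s + t) at_top at_top"
      by (rule filterlim_tendsto_add_at_top[OF tendsto_const filterlim_ident])
    then have "filterlim (\<lambda>t. t - s) at_top at_top" by (simp add: algebra_simps)
    from eventually_compose_filterlim[OF le this]
    have le': "\<forall>\<^sub>F t in at_top. \<bar>L - f (t - s)\<bar> \<le> K * exp (- b' * (t - s))" .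
    show "\<forall>\<^sub>F t in at_top. ereal (1 / t) * eln \<bar>L - f (t - s)\<bar> \<le> ereal (- b)"
      using le' eventually_gt_at_top[of 0] eventually_ge_at_top[of "(ln K + b' * s) / (b' - b)"]
    proof eventually_elim
      case (elim t)
      have "ln K + b' * s \<le> (b' - b) * t" using elim b' by (simp add: field_simps)
      then have "ln K + - b' * (t - s) \<le> - b * t" by (simp add: algebra_simps)
      then have "exp (ln K + - b' * (t - s)) \<le> exp (- b * t)" by simp
      then have "K * exp (- b' * (t - s)) \<le> exp (- b * t)" using K by (simp only: exp_add exp_ln)
      then show ?case using elim by (intro eln_rate_le) auto
    qed
  qed
  show "Limsup at_top (\<lambda>t. ereal (1 / t) * eln \<bar>L - f (t - s)\<bar>) \<le> ereal (- c)"
  proof (rule ereal_le_epsilon2)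
    fix e :: real assume e: "0 < e"
    define b where "b = max (c / 2) (c - e)"
    have "0 < b" "b < c" "- b \<le> - c + e" using c e by (auto simp: b_def)
    from up[OF this(1,2)] have "Limsup at_top (\<lambda>t. ereal (1 / t) * eln \<bar>L - f (t - s)\<bar>) \<le> ereal (- b)" .
    also have "\<dots> \<le> ereal (- c) + ereal e" using \<open>- b \<le> - c + e\<close> by simp
    finally show "Limsup at_top (\<lambda>t. ereal (1 / t) * eln \<bar>L - f (t - s)\<bar>) \<le> ereal (- c) + ereal e" .
  qed
  have lo: "ereal (- a) \<le> Limsup at_top (\<lambda>t. ereal (1 / t) * eln \<bar>L - f (t - s)\<bar>)" if a: "c < a" for a
  proof (rule frequently_le_Limsup)
    define a' where "a' = (a + c) / 2"
    have a': "c < a'" "a' < a" using a by (auto simp: a'_def)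
    obtain n0 where n0: "\<And>n. n0 \<le> n \<Longrightarrow> exp (- a' * real n) < \<bar>f (real n + 1) - f (real n)\<bar>"
      using lower[OF a'(1)] by (auto simp: eventually_sequentially)
    show "\<exists>\<^sub>F t in at_top. ereal (- a) \<le> ereal (1 / t) * eln \<bar>L - f (t - s)\<bar>"
      unfolding frequently_def eventually_at_top_linorder
    proof
      assume "\<exists>N. \<forall>t\<ge>N. \<not> ereal (- a) \<le> ereal (1 / t) * eln \<bar>L - f (t - s)\<bar>"
      then obtain N where N: "\<And>t. N \<le> t \<Longrightarrow> \<not> ereal (- a) \<le> ereal (1 / t) * eln \<bar>L - f (t - s)\<bar>" by blast
      obtain n where n: "n0 \<le> n" "N \<le> real n" "ln 2 / (a - a') \<le> real n" "1 \<le> n"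
      proof -
        obtain n1 where "max N (ln 2 / (a - a')) \<le> real n1" using real_arch_simple by blast
        then show ?thesis by (intro that[of "max 1 (max n0 n1)"]) auto
      qed
      have small: "\<bar>L - f u\<bar> < exp (- a' * real n) / 2" if u: "u = real n \<or> u = real n + 1" for u
      proof -
        have t: "N \<le> u + s" "0 < u + s" "real n \<le> u + s" using n s u by auto
        have "\<bar>L - f u\<bar> < exp (- a * (u + s))"
          using eln_rate_ge[OF t(2), of a "\<bar>L - f u\<bar>"] N[OF t(1)] by fastforce
        also have "\<dots> \<le> exp (- a * real n)" using t a c by simp
        also have "\<dots> \<le> exp (- a' * real n - ln 2)"
          using n(3) a' by (simp add: field_simps)
        also have "\<dots> = exp (- a' * real n) / 2" by (simp add: exp_diff)
        finally show ?thesis .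
      qed
      from small[of "real n"] small[of "real n + 1"] n0[OF n(1)] show False by linarith
    qed
  qed
  show "ereal (- c) \<le> Limsup at_top (\<lambda>t. ereal (1 / t) * eln \<bar>L - f (t - s)\<bar>)"
  proof (rule ereal_le_epsilon2)
    fix e :: real assume e: "0 < e"
    have "ereal (- c) = ereal (- (c + e)) + ereal e" by simp
    also have "\<dots> \<le> Limsup at_top (\<lambda>t. ereal (1 / t) * eln \<bar>L - f (t - s)\<bar>) + ereal e"
      using e by (intro add_right_mono lo) simp
    finally show "ereal (- c) \<le> Limsup at_top (\<lambda>t. ereal (1 / t) * eln \<bar>L - f (t - s)\<bar>) + ereal e" .
  qed
qed

lemma rmod_locally_translation:
  fixes y :: "real \<Rightarrow> real"
  assumes m: "0 < m" and lim: "(y \<longlongrightarrow> l) F" and l: "l rmod m \<noteq> 0"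
  shows "\<forall>\<^sub>F t in F. y t rmod m - l rmod m = y t - l"
proof -
  define d where "d = l rmod m"
  have d: "0 < d" "d < m" using l rmod_nonneg[of m l] rmod_less[OF m, of l] m by (auto simp: d_def)
  have "\<forall>\<^sub>F t in F. dist (y t) l < min d (m - d)" using d by (intro tendstoD[OF lim]) auto
  then show ?thesis
  proof eventually_elim
    case (elim t)
    have "y t rmod m = d + (y t - l)"
    proof (rule rmod_unique)
      show "d + (y t - l) \<in> {0..<\<bar>m\<bar>}" using elim d by (auto simp: dist_real_def)
      show "y t = d + (y t - l) + of_int \<lfloor>l / m\<rfloor> * m"
        using m by (simp add: d_def rmod_def)
    qed
    then show ?case by (simp add: d_def)
  qed
qed

lemma rmod_near_multiple:
  fixes y :: "'b \<Rightarrow> real"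
  assumes m: "0 < m" and lim: "(y \<longlongrightarrow> l) F" and l: "l rmod m = 0" and e: "0 < e"
  shows "\<forall>\<^sub>F t in F. y t rmod m < e \<or> m - e < y t rmod m"
proof -
  have "\<forall>\<^sub>F t in F. dist (y t) l < min e m" using e m by (intro tendstoD[OF lim]) auto
  then show ?thesis
  proof eventually_elim
    case (elim t)
    have l': "l = of_int \<lfloor>l / m\<rfloor> * m" using l m by (simp add: rmod_def mult.commute)
    show ?case
    proof (cases "l \<le> y t")
      case True
      have "y t rmod m = y t - l"
        by (rule rmod_unique[where n = "\<lfloor>l / m\<rfloor>"]) (use True elim l' m in \<open>auto simp: dist_real_def\<close>)
      then show ?thesis using True elim by (auto simp: dist_real_def)
    next
      case False
      have "y t rmod m = y t - l + m"
      proof (rule rmod_unique[where n = "\<lfloor>l / m\<rfloor> - 1"])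
        show "y t = y t - l + m + of_int (\<lfloor>l / m\<rfloor> - 1) * m" using l' by (simp add: algebra_simps)
      qed (use False elim m in \<open>auto simp: dist_real_def\<close>)
      then show ?thesis using False elim by (auto simp: dist_real_def)
    qed
  qed
qed

section \<open>Convergence of the winding\<close>

lemma geometric_tail_AE_eventually:
  fixes M :: "'b measure"
  assumes M: "finite_measure M" and G: "\<And>n. G n \<in> sets M"
    and le: "\<And>n. n0 \<le> n \<Longrightarrow> measure M (G n) \<le> K * exp (- c * real n)" and c: "0 < c"
  shows "AE \<omega> in M. \<forall>\<^sub>F n in sequentially. \<omega> \<in> space M - G n"
proof (rule borel_cantelli_AE1)
  interpret finite_measure M by (rule M)
  show "G n \<in> sets M" for n by (rule G)
  show "emeasure M (G n) < \<infinity>" for n by (simp add: emeasure_eq_measure)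
  show "summable (\<lambda>n. measure M (G n))"
  proof (rule summable_comparison_test'[where N = n0])
    have "exp (- c * real n) = exp (- c) ^ n" for n by (simp add: mult.commute flip: exp_of_nat_mult)
    then show "summable (\<lambda>n. K * exp (- c * real n))"
      using c by (simp only:) (intro summable_mult summable_geometric, simp)
    show "norm (measure M (G n)) \<le> K * exp (- c * real n)" if "n0 \<le> n" for n using le[OF that] by simp
  qed
qed

text \<open>
  The surplus \<open>2\<close> in the lower bound for \<open>x\<close> absorbs the constants in \<open>sinh x \<ge> (e\<^sup>x - 1) / 2\<close>.
\<close>

lemma inverse_sinh_bounds:
  fixes a b u x :: real
  assumes u: "0 < u" and lin: "b * u + 2 \<le> x" "x \<le> a * u" and b: "0 < b"
  shows "exp (- a * u) \<le> 1 / sinh x" "1 / sinh x \<le> exp (- b * u)"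
proof -
  have x: "2 \<le> x" using lin u b by (smt (verit) mult_pos_pos)
  then have pos: "0 < sinh x" by simp
  have "sinh x \<le> exp x" unfolding sinh_field_def by (simp add: field_simps)
  also have "\<dots> \<le> exp (a * u)" using lin by simp
  finally have "sinh x \<le> exp (a * u)" .
  then show "exp (- a * u) \<le> 1 / sinh x" using pos by (simp add: exp_minus field_simps)
  have "exp (b * u) * 4 \<le> exp (b * u) * exp 2"
  proof -
    have "(2::real) \<le> exp 1" using exp_ge_add_one_self[of 1] by simp
    then have "(2::real) * 2 \<le> exp 1 * exp 1" by (intro mult_mono) auto
    then have "(4::real) \<le> exp 2" by (simp flip: exp_add)
    then show ?thesis by (intro mult_left_mono) auto
  qed
  also have "\<dots> = exp (b * u + 2)" by (simp add: exp_add)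
  also have "\<dots> \<le> exp x" using lin by simp
  finally have "4 * exp (b * u) \<le> exp x" by simp
  moreover have "1 \<le> exp (b * u)" using b u by simp
  moreover have "exp (- x) \<le> 1" using x by simp
  moreover have "sinh x = (exp x - exp (- x)) / 2" by (simp add: sinh_field_def)
  moreover have "y \<le> (z - e) / 2" if "4 * y \<le> z" "1 \<le> y" "e \<le> 1" for y z e :: real
    using that by (simp add: field_simps)
  ultimately have "exp (b * u) \<le> sinh x" by presburger
  then show "1 / sinh x \<le> exp (- b * u)" using pos by (simp add: exp_minus field_simps)
qed

context hyperbolic_brownian_motion
begin

text \<open>
  From time \<open>N\<close> on, the integrand lies between two deterministic exponentials. Only dyadic times are
  tested: they are the points of the Riemann sums, and countably many conditions define an event.
\<close>

definition integrand_controlled :: "real \<Rightarrow> real \<Rightarrow> real \<Rightarrow> nat \<Rightarrow> 'a set" where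
  "integrand_controlled s a b N = {\<omega> \<in> space M. \<forall>m k. real N \<le> real k / 2 ^ m \<longrightarrow>
     exp (- a * (real k / 2 ^ m)) \<le> 1 / sinh (R (s + real k / 2 ^ m) \<omega>) \<and>
     1 / sinh (R (s + real k / 2 ^ m) \<omega>) \<le> exp (- b * (real k / 2 ^ m))}"

lemma integrand_controlled_event: "0 < s \<Longrightarrow> integrand_controlled s a b N \<in> events"
proof -
  assume s: "0 < s"
  have [measurable]: "random_variable borel (R (s + real k / 2 ^ m))" for k m
    using s by (intro R_measurable) simp
  have [measurable]: "(sinh :: real \<Rightarrow> real) \<in> borel_measurable borel"
    by (intro borel_measurable_continuous_onI continuous_intros)
  show ?thesis unfolding integrand_controlled_def by measurable
qed

lemma AE_integrand_controlled:
  assumes s: "0 < s" and b: "0 < b" "b < 1 / 2" and a: "1 / 2 < a"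
  shows "AE \<omega> in M. \<exists>N. \<omega> \<in> integrand_controlled s a b N"
  using AE_speed AE_space
proof eventually_elim
  case (elim \<omega>)
  \<comment> \<open>Speeds strictly between \<open>1/2\<close> and the exponents leave room for the shift by \<open>s\<close> and for the
  surplus \<open>2\<close>.\<close>
  define b' where "b' = (b + 1 / 2) / 2"
  define a' where "a' = (a + 1 / 2) / 2"
  have ab: "b < b'" "b' < 1 / 2" "1 / 2 < a'" "a' < a" using a b by (auto simp: a'_def b'_def)
  have "\<forall>\<^sub>F t in at_top. b' < R t \<omega> / t" "\<forall>\<^sub>F t in at_top. R t \<omega> / t < a'"
    using elim ab by (auto intro: order_tendstoD)
  then have "\<forall>\<^sub>F t in at_top. b' * t \<le> R t \<omega> \<and> R t \<omega> \<le> a' * t"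
    using eventually_gt_at_top[of 0] by eventually_elim (auto simp: field_simps)
  then obtain T where T: "\<And>t. T \<le> t \<Longrightarrow> b' * t \<le> R t \<omega> \<and> R t \<omega> \<le> a' * t"
    by (auto simp: eventually_at_top_linorder)
  obtain N where N: "max T (max 1 (max (2 / (b' - b)) (a' * s / (a - a')))) \<le> real N"
    using real_arch_simple by blast
  have "\<omega> \<in> integrand_controlled s a b N"
    unfolding integrand_controlled_def
  proof (safe)
    show "\<omega> \<in> space M" using elim by simp
    fix m k assume u: "real N \<le> real k / 2 ^ m"
    define u where "u = real k / 2 ^ m"
    have uN: "T \<le> s + u" "0 < u" "2 / (b' - b) \<le> u" "a' * s / (a - a') \<le> u"
      using N u s by (auto simp: u_def)
    have "b * u + 2 \<le> b' * u" using uN(3) ab by (simp add: field_simps)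
    also have "\<dots> \<le> b' * (s + u)" using ab b s by simp
    also have "\<dots> \<le> R (s + u) \<omega>" using T[OF uN(1)] by simp
    finally have lo: "b * u + 2 \<le> R (s + u) \<omega>" .
    have "R (s + u) \<omega> \<le> a' * (s + u)" using T[OF uN(1)] by simp
    also have "\<dots> \<le> a * u" using uN(4) ab by (simp add: field_simps)
    finally have hi: "R (s + u) \<omega> \<le> a * u" .
    from inverse_sinh_bounds[OF uN(2) lo hi b(1)]
    show "exp (- a * (real k / 2 ^ m)) \<le> 1 / sinh (R (s + real k / 2 ^ m) \<omega>)"
      "1 / sinh (R (s + real k / 2 ^ m) \<omega>) \<le> exp (- b * (real k / 2 ^ m))"
      by (auto simp: u_def)
  qed
  then show ?case ..
qed

text \<open>
  As the radius has speed \<open>1/2\<close>, the control sets increase to a set of full measure, so it suffices to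
  argue on each of them.
\<close>

lemma AE_integrand_controlledI:
  assumes "0 < s" "0 < b" "b < 1 / 2" "1 / 2 < a"
    and "\<And>N. AE \<omega> in M. \<omega> \<in> integrand_controlled s a b N \<longrightarrow> P \<omega>"
  shows "AE \<omega> in M. P \<omega>"
proof -
  have "AE \<omega> in M. \<forall>N. \<omega> \<in> integrand_controlled s a b N \<longrightarrow> P \<omega>"
    unfolding AE_all_countable using assms(5) by blast
  with AE_integrand_controlled[OF assms(1-4)] show ?thesis by eventually_elim auto
qed

text \<open>
  The bounds of \<open>winding_increment_tails\<close> in the form that chaining over \<open>[n, n + 1]\<close> needs: the
  exponential bounds on the integrand are taken at the two ends of that interval.
\<close>

lemma controlled_increment_tails:
  assumes s: "0 < s" and n: "N \<le> n" and k: "k < 2 ^ m" and a: "0 < a" and b: "0 < b" "b \<le> a"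
  defines "D \<equiv> \<lambda>\<omega>. \<Theta> s (s + real (n * 2 ^ m + Suc k) / 2 ^ m) \<omega> - \<Theta> s (s + real (n * 2 ^ m + k) / 2 ^ m) \<omega>"
  shows "0 < x \<Longrightarrow> prob {\<omega> \<in> integrand_controlled s a b N. x < \<bar>D \<omega>\<bar>}
      \<le> 3 * exp (- b * real n) ^ 4 / (4 ^ m * x ^ 4)"
    and "0 \<le> y \<Longrightarrow> prob {\<omega> \<in> integrand_controlled s a b N. \<bar>D \<omega>\<bar> \<le> y}
      \<le> y / (exp (- a * (real n + 1)) * sqrt (1 / 2 ^ m))"
proof -
  let ?j = "n * 2 ^ m + k"
  let ?lo = "exp (- a * (real n + 1))" and ?hi = "exp (- b * real n)"
  have H: "?lo \<le> 1 / sinh (R (s + real i / 2 ^ (m + l)) \<omega>) \<and> 1 / sinh (R (s + real i / 2 ^ (m + l)) \<omega>) \<le> ?hi"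
    if w: "\<omega> \<in> integrand_controlled s a b N" and i: "?j * 2 ^ l \<le> i" "i < Suc ?j * 2 ^ l" for \<omega> l i
  proof -
    define u where "u = real i / 2 ^ (m + l)"
    have "n * 2 ^ (m + l) \<le> ?j * 2 ^ l" by (simp add: power_add algebra_simps)
    with i have "n * 2 ^ (m + l) \<le> i" by linarith
    then have "real (n * 2 ^ (m + l)) \<le> real i" by (rule of_nat_mono)
    then have un: "real n \<le> u" by (simp add: u_def field_simps)
    have "Suc ?j * 2 ^ l \<le> (n * 2 ^ m + 2 ^ m) * 2 ^ l" using k by (intro mult_right_mono) auto
    also have "\<dots> = (n + 1) * 2 ^ (m + l)" by (simp add: power_add algebra_simps)
    finally have "i \<le> (n + 1) * 2 ^ (m + l)" using i by linarith
    then have "real i \<le> real ((n + 1) * 2 ^ (m + l))" by (rule of_nat_mono)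
    then have un': "u \<le> real n + 1" by (simp add: u_def field_simps)
    have "real N \<le> u" using un n by simp
    then have "exp (- a * u) \<le> 1 / sinh (R (s + u) \<omega>)" "1 / sinh (R (s + u) \<omega>) \<le> exp (- b * u)"
      using w by (auto simp: integrand_controlled_def u_def)
    moreover have "?lo \<le> exp (- a * u)" "exp (- b * u) \<le> ?hi" using un un' a b by auto
    ultimately show ?thesis unfolding u_def by linarith
  qed
  have lohi: "?lo \<le> ?hi"
  proof -
    have "b * real n \<le> a * (real n + 1)" using a b by (intro mult_mono) auto
    then show ?thesis by simp
  qed
  note * = winding_increment_tails[OF s integrand_controlled_event[OF s] lessI[of ?j] exp_gt_zero H lohi]
  show "prob {\<omega> \<in> integrand_controlled s a b N. x < \<bar>D \<omega>\<bar>} \<le> 3 * ?hi ^ 4 / (4 ^ m * x ^ 4)" if "0 < x"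
  proof -
    have "prob {\<omega> \<in> integrand_controlled s a b N. x < \<bar>D \<omega>\<bar>} \<le> 3 * (?hi\<^sup>2 * (1 / 2 ^ m))\<^sup>2 / x ^ 4"
      using *(1)[OF _ _ _ that] unfolding D_def by simp
    also have "\<dots> = 3 * ?hi ^ 4 / (4 ^ m * x ^ 4)"
    proof -
      have "((2::real) ^ m)\<^sup>2 = 4 ^ m" by (simp add: power2_eq_square flip: power_mult_distrib)
      then show ?thesis by (simp add: power_mult_distrib power_divide flip: power_mult)
    qed
    finally show ?thesis .
  qed
  show "prob {\<omega> \<in> integrand_controlled s a b N. \<bar>D \<omega>\<bar> \<le> y} \<le> y / (?lo * sqrt (1 / 2 ^ m))" if "0 \<le> y"
    using *(2)[OF _ _ _ that] unfolding D_def by simp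
qed

text \<open>
  On a control set with \<open>c < b < 1/2\<close>, chaining bounds the probability of an oscillation above
  \<open>e\<^bsup>-c n\<^esup>\<close> by a multiple of \<open>(e\<^bsup>-b n\<^esup> / e\<^bsup>-c n\<^esup>)\<^sup>4\<close>.
\<close>

lemma AE_winding_oscillation:
  assumes s: "0 < s" and c: "0 < c" "c < 1 / 2"
  shows "AE \<omega> in M. \<forall>\<^sub>F n in sequentially. \<forall>t\<in>{real n..real n + 1}.
    \<bar>\<Theta> s (s + t) \<omega> - \<Theta> s (s + real n) \<omega>\<bar> \<le> exp (- c * real n)"
proof -
  define b where "b = (c + 1 / 2) / 2"
  have b: "0 < b" "b < 1 / 2" "c < b" using c by (auto simp: b_def)
  have cont: "AE \<omega> in M. continuous_on {s..} (\<lambda>t. \<Theta> s t \<omega>)"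
    using winding_sde[OF s] by (simp add: ito_integral_from_def)
  show ?thesis
  proof (rule AE_integrand_controlledI[OF s b(1,2)])
    fix N
    let ?A = "integrand_controlled s 1 b N"
    define p where "p = (\<lambda>n m k. real n + (real n + 1 - real n) * real k / 2 ^ m)"
    define E where "E = (\<lambda>n. {\<omega> \<in> ?A. \<exists>m. \<exists>k\<le>2 ^ m. exp (- c * real n) < \<bar>\<Theta> s (s + p n m k) \<omega> - \<Theta> s (s + real n) \<omega>\<bar>})"
    \<comment> \<open>Before time \<open>N\<close> the integrand is not controlled, and the event is replaced by the empty set.\<close>
    define G where "G = (\<lambda>n. if N \<le> n then E n else {})"
    have p: "p n m k = real (n * 2 ^ m + k) / 2 ^ m" for n m k by (simp add: p_def field_simps)
    have E: "E n \<in> events" "prob (E n) \<le> 50000 * (3 * exp (- b * real n) ^ 4) / exp (- c * real n) ^ 4" if n: "N \<le> n" for n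
    proof -
      have pe: "p n m k = real n + (real n + 1 - real n) * real k / 2 ^ m" for m k by (simp add: p_def)
      have meas: "random_variable borel (\<Theta> s (s + p n m k))" if "k \<le> 2 ^ m" for m k
        using s by (intro \<Theta>_measurable) (auto simp: p)
      have tail: "prob {\<omega> \<in> ?A. x < \<bar>\<Theta> s (s + p n m (Suc k)) \<omega> - \<Theta> s (s + p n m k) \<omega>\<bar>}
          \<le> 3 * exp (- b * real n) ^ 4 / (4 ^ m * x ^ 4)" if "k < 2 ^ m" "0 < x" for m k x

        unfolding p by (rule controlled_increment_tails(1)[OF s n that(1) _ b(1) _ that(2)]) (use b in auto)
      note * = chaining_tail_bound[where X = "\<lambda>u. \<Theta> s (s + u)" and p = "p n"
          and x = "exp (- c * real n)", OF pe integrand_controlled_event[OF s] meas tail exp_gt_zero]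
      show "E n \<in> events" unfolding E_def by (rule *(1))
      show "prob (E n) \<le> 50000 * (3 * exp (- b * real n) ^ 4) / exp (- c * real n) ^ 4"
        unfolding E_def by (rule *(2))
    qed
    have "AE \<omega> in M. \<forall>\<^sub>F n in sequentially. \<omega> \<in> space M - G n"
    proof (rule geometric_tail_AE_eventually[OF finite_measure_axioms])
      show "G n \<in> events" for n using E(1) by (simp add: G_def)
      show "prob (G n) \<le> 150000 * exp (- (4 * (b - c)) * real n)" if "N \<le> n" for n
      proof -
        have "50000 * (3 * exp (- b * real n) ^ 4) / exp (- c * real n) ^ 4
            = 150000 * exp (- (4 * (b - c)) * real n)"
        proof -
          have e4: "exp x ^ 4 = exp (4 * x)" for x :: real using exp_of_nat_mult[of 4 x] by simp
          have "exp (- b * real n) ^ 4 / exp (- c * real n) ^ 4 = exp (- (4 * (b - c)) * real n)"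
            unfolding e4 exp_diff[symmetric] by (simp add: algebra_simps)
          then show ?thesis by simp
        qed
        then show ?thesis using E(2)[OF that] that by (simp add: G_def)
      qed
    qed (use b in simp)
    with cont show "AE \<omega> in M. \<omega> \<in> ?A \<longrightarrow> (\<forall>\<^sub>F n in sequentially. \<forall>t\<in>{real n..real n + 1}.
      \<bar>\<Theta> s (s + t) \<omega> - \<Theta> s (s + real n) \<omega>\<bar> \<le> exp (- c * real n))"
    proof eventually_elim
      case (elim \<omega>)
      show ?case
      proof
        assume A: "\<omega> \<in> ?A"
        show "\<forall>\<^sub>F n in sequentially. \<forall>t\<in>{real n..real n + 1}.
          \<bar>\<Theta> s (s + t) \<omega> - \<Theta> s (s + real n) \<omega>\<bar> \<le> exp (- c * real n)"
          using elim(2) eventually_ge_at_top[of N]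
        proof eventually_elim
          case (elim n)
          show ?case
          proof (intro ballI, rule le_of_dyadic_le[where f = "\<lambda>u. \<Theta> s (s + u) \<omega>" and b = "real n + 1"])
            show "continuous_on {real n..real n + 1} (\<lambda>u. \<Theta> s (s + u) \<omega>)"
              by (rule continuous_on_compose2[OF \<open>continuous_on {s..} (\<lambda>t. \<Theta> s t \<omega>)\<close>])
                (auto intro!: continuous_intros)
            show "\<bar>\<Theta> s (s + (real n + (real n + 1 - real n) * real k / 2 ^ m)) \<omega> - \<Theta> s (s + real n) \<omega>\<bar>
                \<le> exp (- c * real n)" if "k \<le> 2 ^ m" for m k
              using elim A that by (auto simp: G_def E_def p_def not_less)
          qed
        qed
      qed
    qed
  qed simp
qed

text \<open>
  On a control set with \<open>1/2 < a < c\<close>, the increment over \<open>[n, n + 1]\<close> is conditionally normal with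
  standard deviation at least \<open>e\<^bsup>-a (n + 1)\<^esup>\<close>, so it is below \<open>e\<^bsup>-c n\<^esup>\<close> with probability of order
  \<open>e\<^bsup>-(c - a) n\<^esup>\<close>.
\<close>

lemma AE_winding_increments_large:
  assumes s: "0 < s" and c: "1 / 2 < c"
  shows "AE \<omega> in M. \<forall>\<^sub>F n in sequentially.
    exp (- c * real n) < \<bar>\<Theta> s (s + (real n + 1)) \<omega> - \<Theta> s (s + real n) \<omega>\<bar>"
proof -
  define a where "a = (c + 1 / 2) / 2"
  have a: "1 / 2 < a" "a < c" using c by (auto simp: a_def)
  show ?thesis
  proof (rule AE_integrand_controlledI[OF s _ _ a(1), of "1 / 4"])
    fix N
    let ?A = "integrand_controlled s a (1 / 4) N"
    define E where "E = (\<lambda>n. {\<omega> \<in> ?A. \<bar>\<Theta> s (s + (real n + 1)) \<omega> - \<Theta> s (s + real n) \<omega>\<bar> \<le> exp (- c * real n)})"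
    have E: "E n \<in> events" for n
    proof -
      have [measurable]: "random_variable borel (\<Theta> s (s + real n))" "random_variable borel (\<Theta> s (s + (real n + 1)))"
        using s by (auto intro!: \<Theta>_measurable)
      note [measurable] = integrand_controlled_event[OF s, of a "1 / 4" N]
      have "E n = ?A \<inter> {\<omega> \<in> space M. \<bar>\<Theta> s (s + (real n + 1)) \<omega> - \<Theta> s (s + real n) \<omega>\<bar> \<le> exp (- c * real n)}"
        by (auto simp: E_def integrand_controlled_def)
      also have "\<dots> \<in> events" by measurable
      finally show ?thesis .
    qed
    have "AE \<omega> in M. \<forall>\<^sub>F n in sequentially. \<omega> \<in> space M - E n"
    proof (rule geometric_tail_AE_eventually[OF finite_measure_axioms E])
      fix n assume n: "N \<le> n"
      have "prob (E n) \<le> exp (- c * real n) / (exp (- a * (real n + 1)) * sqrt (1 / 2 ^ 0))"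
        using controlled_increment_tails(2)[OF s n, of 0 0 a "1 / 4" "exp (- c * real n)"] a
        by (simp add: E_def add_ac)
      also have "\<dots> = exp a * exp (- (c - a) * real n)"
        by (simp add: algebra_simps flip: exp_diff exp_add)
      finally show "prob (E n) \<le> exp a * exp (- (c - a) * real n)" .
    qed (use a in simp)
    then show "AE \<omega> in M. \<omega> \<in> ?A \<longrightarrow> (\<forall>\<^sub>F n in sequentially.
      exp (- c * real n) < \<bar>\<Theta> s (s + (real n + 1)) \<omega> - \<Theta> s (s + real n) \<omega>\<bar>)"
    proof eventually_elim
      case (elim \<omega>)
      show ?case
      proof
        assume A: "\<omega> \<in> ?A"
        from elim show "\<forall>\<^sub>F n in sequentially.
          exp (- c * real n) < \<bar>\<Theta> s (s + (real n + 1)) \<omega> - \<Theta> s (s + real n) \<omega>\<bar>"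
          by eventually_elim (use A in \<open>auto simp: E_def not_le\<close>)
      qed
    qed
  qed auto
qed

text \<open>
  A limit along integer times is a random variable by construction.
\<close>

definition winding_limit :: "real \<Rightarrow> 'a \<Rightarrow> real" where
  "winding_limit s \<omega> = lim (\<lambda>n. \<Theta> s (s + real n) \<omega>)"

lemma winding_limit_measurable: "0 < s \<Longrightarrow> random_variable borel (winding_limit s)"
  unfolding winding_limit_def[abs_def]
  by (intro borel_measurable_lim_metric \<Theta>_measurable) auto

lemma AE_winding_limit:
  assumes s: "0 < s"
  shows "AE \<omega> in M. ((\<lambda>t. \<Theta> s t \<omega>) \<longlongrightarrow> winding_limit s \<omega>) at_top \<and>
    Limsup at_top (\<lambda>t. ereal (1 / t) * eln \<bar>winding_limit s \<omega> - \<Theta> s t \<omega>\<bar>) = ereal (- (1 / 2))"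
proof -
  have "AE \<omega> in M. \<forall>i::nat. \<forall>\<^sub>F n in sequentially. \<forall>t\<in>{real n..real n + 1}.
    \<bar>\<Theta> s (s + t) \<omega> - \<Theta> s (s + real n) \<omega>\<bar> \<le> exp (- (1 / 2 - 1 / real (i + 3)) * real n)"
    unfolding AE_all_countable
    by (intro allI AE_winding_oscillation[OF s]) (auto simp: field_simps)
  moreover have "AE \<omega> in M. \<forall>i::nat. \<forall>\<^sub>F n in sequentially.
    exp (- (1 / 2 + 1 / real (i + 1)) * real n) < \<bar>\<Theta> s (s + (real n + 1)) \<omega> - \<Theta> s (s + real n) \<omega>\<bar>"
    unfolding AE_all_countable
    by (intro allI AE_winding_increments_large[OF s]) auto
  ultimately show ?thesis
  proof eventually_elim
    case (elim \<omega>)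
    define f where "f = (\<lambda>u. \<Theta> s (s + u) \<omega>)"
    have osc: "\<exists>L K. (f \<longlongrightarrow> L) at_top \<and> 0 < K \<and> (\<forall>\<^sub>F t in at_top. \<bar>L - f t\<bar> \<le> K * exp (- b * t))"
      if b: "0 < b" "b < 1 / 2" for b
    proof (rule geometric_oscillation_limit[OF b(1)])
      obtain i where i: "1 / real (Suc i) < 1 / 2 - b" using nat_approx_posE[of "1 / 2 - b"] b by auto
      have "1 / real (i + 3) \<le> 1 / real (Suc i)" by (intro divide_left_mono) auto
      with i have "b \<le> 1 / 2 - 1 / real (i + 3)" by linarith
      then have "b * real n \<le> (1 / 2 - 1 / real (i + 3)) * real n" for n by (rule mult_right_mono) simp
      then have le: "exp (- (1 / 2 - 1 / real (i + 3)) * real n) \<le> exp (- b * real n)" for n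
        by (simp only: exp_le_cancel_iff mult_minus_left neg_le_iff_le)
      show "\<forall>\<^sub>F n in sequentially. \<forall>t\<in>{real n..real n + 1}. \<bar>f t - f (real n)\<bar> \<le> exp (- b * real n)"
        using elim(1)[rule_format, of i]
      proof eventually_elim
        case (elim n)
        then show ?case unfolding f_def using le[of n] order_trans by blast
      qed
    qed
    obtain L where L: "(f \<longlongrightarrow> L) at_top" using osc[of "1 / 4"] by auto
    have "filterlim (\<lambda>t. - s + t) at_top at_top"
      by (rule filterlim_tendsto_add_at_top[OF tendsto_const filterlim_ident])
    from filterlim_compose[OF L this] have lim: "((\<lambda>t. \<Theta> s t \<omega>) \<longlongrightarrow> L) at_top"
      by (simp add: f_def)
    have "winding_limit s \<omega> = L"
      unfolding winding_limit_def using filterlim_compose[OF L filterlim_real_sequentially]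
      by (intro limI) (simp add: f_def)
    moreover have "Limsup at_top (\<lambda>t. ereal (1 / t) * eln \<bar>L - f (t - s)\<bar>) = ereal (- (1 / 2))"
    proof (rule Limsup_exponential_rate)
      show "\<exists>K>0. \<forall>\<^sub>F t in at_top. \<bar>L - f t\<bar> \<le> K * exp (- b * t)" if "0 < b" "b < 1 / 2" for b
        using osc[OF that] tendsto_unique[OF _ L] by (metis trivial_limit_at_top_linorder)
      show "\<forall>\<^sub>F n in sequentially. exp (- a * real n) < \<bar>f (real n + 1) - f (real n)\<bar>" if a: "1 / 2 < a" for a
      proof -
        obtain i where i: "1 / real (Suc i) < a - 1 / 2" using nat_approx_posE[of "a - 1 / 2"] a by auto
        then have "1 / 2 + 1 / real (i + 1) \<le> a" by simp
        then have "(1 / 2 + 1 / real (i + 1)) * real n \<le> a * real n" for n by (rule mult_right_mono) simp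
        then have "exp (- a * real n) \<le> exp (- (1 / 2 + 1 / real (i + 1)) * real n)" for n
          by (simp only: exp_le_cancel_iff mult_minus_left neg_le_iff_le)
        note le = this
        show ?thesis
          using elim(2)[rule_format, of i]
        proof eventually_elim
          case (elim n)
          then show ?case unfolding f_def using le[of n] by linarith
        qed
      qed
    qed (use s in auto)
    ultimately show ?case using lim by (simp add: f_def)
  qed
qed

end

section \<open>The limiting angle and the rates\<close>

text \<open>
  The characteristic functions of the sequence are constant and converge to that of the limit.
\<close>

lemma (in prob_space) AE_limit_same_distribution:
  fixes X :: "nat \<Rightarrow> 'a \<Rightarrow> real"
  assumes X: "\<And>n. random_variable borel (X n)" and Y: "random_variable borel Y"
    and law: "\<And>n. distr M borel (X n) = D"
    and lim: "AE \<omega> in M. (\<lambda>n. X n \<omega>) \<longlonglongrightarrow> Y \<omega>"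
  shows "distr M borel Y = D"
proof (rule Levy_uniqueness)
  show "real_distribution (distr M borel Y)" by (rule real_distribution_distr[OF Y])
  show "real_distribution D" using real_distribution_distr[OF X[of 0]] law by simp
  show "char (distr M borel Y) = char D"
  proof
    fix t
    have char: "char (distr M borel Z) t = (CLINT \<omega>|M. iexp (t * Z \<omega>))" if "random_variable borel Z" for Z
      unfolding char_def using that by (subst integral_distr) auto
    have "(\<lambda>n. CLINT \<omega>|M. iexp (t * X n \<omega>)) \<longlonglongrightarrow> (CLINT \<omega>|M. iexp (t * Y \<omega>))"
    proof (rule integral_dominated_convergence[where w = "\<lambda>_. 1"])
      show "AE \<omega> in M. (\<lambda>n. iexp (t * X n \<omega>)) \<longlonglongrightarrow> iexp (t * Y \<omega>)"
        using lim by eventually_elim (intro tendsto_intros)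
    qed (use X Y in \<open>auto intro!: always_eventually\<close>)
    then have "(\<lambda>n. char D t) \<longlonglongrightarrow> char (distr M borel Y) t"
      using char[OF X] char[OF Y] by (simp add: law)
    then show "char (distr M borel Y) t = char D t" by (simp add: LIMSEQ_const_iff)
  qed
qed

context hyperbolic_brownian_motion
begin

abbreviation angle :: "real \<Rightarrow> 'a \<Rightarrow> real" where "angle t \<omega> \<equiv> polar_angle (B t \<omega>)"

lemma angle_measurable: "0 < t \<Longrightarrow> random_variable borel (angle t)"
  using angle_uniform[of t] by (simp add: uniform_angle_def)

lemma angle_distribution: "0 < t \<Longrightarrow> distr M borel (angle t) = uniform_measure lborel {0..<2 * pi}"
  using angle_uniform[of t] by (simp add: uniform_angle_def)

lemma angle_near_cut:
  assumes t: "0 < t" and e: "0 < e" "e < pi"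
  shows "prob {\<omega> \<in> space M. angle t \<omega> < e \<or> 2 * pi - e < angle t \<omega>} \<le> e"
proof -
  let ?E = "{x. x < e \<or> 2 * pi - e < x}"
  have E: "?E \<in> sets borel"
  proof -
    have "?E = {..<e} \<union> {2 * pi - e<..}" by auto
    then show ?thesis by simp
  qed
  have "prob {\<omega> \<in> space M. angle t \<omega> < e \<or> 2 * pi - e < angle t \<omega>} = measure (distr M borel (angle t)) ?E"
    using E by (subst measure_distr[OF angle_measurable[OF t]]) (auto intro!: arg_cong[where f = prob])
  also have "\<dots> = measure lborel ({0..<2 * pi} \<inter> ?E) / measure lborel {0..<2 * pi}"
    unfolding angle_distribution[OF t] using E by (intro measure_uniform_measure) auto
  also have "{0..<2 * pi} \<inter> ?E = {0..<e} \<union> {2 * pi - e<..<2 * pi}" using e by auto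
  also have "measure lborel ({0..<e} \<union> {2 * pi - e<..<2 * pi}) \<le> measure lborel {0..<e} + measure lborel {2 * pi - e<..<2 * pi}"
    by (rule measure_Un_le) auto
  also have "\<dots> = 2 * e" using e by simp
  finally have "prob {\<omega> \<in> space M. angle t \<omega> < e \<or> 2 * pi - e < angle t \<omega>} \<le> 2 * e / (2 * pi)"
    by (simp add: divide_right_mono)
  also have "\<dots> \<le> e" using e pi_gt3 by (simp add: field_simps)
  finally show ?thesis .
qed

text \<open>
  If \<open>\<theta>\<^sub>s + \<Theta>\<^sub>t\<close> converged to a multiple of \<open>2\<pi>\<close>, the angle would eventually stay within any \<open>e\<close> of the
  cut at \<open>0 = 2\<pi>\<close>, and at each fixed time the uniform angle does this with probability at most \<open>e\<close>.
\<close>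

lemma AE_limit_angle_off_cut:
  assumes s: "0 < s"
  shows "AE \<omega> in M. (angle s \<omega> + winding_limit s \<omega>) rmod (2 * pi) \<noteq> 0"
proof -
  note [measurable] = angle_measurable[OF s] winding_limit_measurable[OF s]
  let ?Z = "{\<omega> \<in> space M. (angle s \<omega> + winding_limit s \<omega>) rmod (2 * pi) = 0}"
  have Z [measurable]: "?Z \<in> events" unfolding rmod_def by measurable
  have "prob ?Z \<le> 0"
  proof (rule field_le_epsilon)
    fix e0 :: real assume e0: "0 < e0"
    define e where "e = min e0 1"
    have e: "0 < e" "e < pi" "e \<le> e0" using e0 pi_gt3 by (auto simp: e_def)
    define C where "C = (\<lambda>N. {\<omega> \<in> space M. \<forall>n\<ge>N. angle (s + real n) \<omega> < e \<or> 2 * pi - e < angle (s + real n) \<omega>})"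
    have am [measurable]: "random_variable borel (angle (s + real n))" for n
      using s by (intro angle_measurable) simp
    have C [measurable]: "C N \<in> events" for N unfolding C_def by measurable
    have "prob (C N) \<le> e" for N
    proof -
      have "prob (C N) \<le> prob {\<omega> \<in> space M. angle (s + real N) \<omega> < e \<or> 2 * pi - e < angle (s + real N) \<omega>}"
        by (rule finite_measure_mono) (auto simp: C_def)
      also have "\<dots> \<le> e" using s e by (intro angle_near_cut) auto
      finally show ?thesis .
    qed
    moreover have "(\<lambda>N. prob (C N)) \<longlonglongrightarrow> prob (\<Union>N. C N)"
      by (rule finite_Lim_measure_incseq) (auto simp: C_def incseq_def intro: order_trans)
    ultimately have "prob (\<Union>N. C N) \<le> e" by (intro LIMSEQ_le_const2) auto
    moreover have "prob ?Z \<le> prob (\<Union>N. C N)"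
    proof (rule finite_measure_mono_AE)
      show "AE \<omega> in M. \<omega> \<in> ?Z \<longrightarrow> \<omega> \<in> (\<Union>N. C N)"
        using AE_winding_limit[OF s] angle_winding[OF s]
      proof eventually_elim
        case (elim \<omega>)
        show ?case
        proof
          assume w: "\<omega> \<in> ?Z"
          have angle_eq: "angle (s + real n) \<omega> = (angle s \<omega> + \<Theta> s (s + real n) \<omega>) rmod (2 * pi)" for n
            using elim(2)[rule_format, of "s + real n"] by simp
          have "filterlim (\<lambda>n. s + real n) at_top sequentially"
            by (rule filterlim_tendsto_add_at_top[OF tendsto_const filterlim_real_sequentially])
          from filterlim_compose[OF conjunct1[OF elim(1)] this]
 have "(\<lambda>n. angle s \<omega> + \<Theta> s (s + real n) \<omega>) \<longlonglongrightarrow> angle s \<omega> + winding_limit s \<omega>"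
            by (intro tendsto_intros)
          then have "\<forall>\<^sub>F n in sequentially. (angle s \<omega> + \<Theta> s (s + real n) \<omega>) rmod (2 * pi) < e \<or>
              2 * pi - e < (angle s \<omega> + \<Theta> s (s + real n) \<omega>) rmod (2 * pi)"
            using w e by (intro rmod_near_multiple) auto
          then have "\<forall>\<^sub>F n in sequentially. angle (s + real n) \<omega> < e \<or> 2 * pi - e < angle (s + real n) \<omega>"
            by (simp only: angle_eq)
          then show "\<omega> \<in> (\<Union>N. C N)" using w by (auto simp: C_def eventually_sequentially)
        qed
      qed
    qed measurable
    ultimately show "prob ?Z \<le> 0 + e0" using e by linarith
  qed
  then have "prob ?Z = 0" by (simp add: measure_le_0_iff)
  then have "AE \<omega> in M. \<omega> \<notin> ?Z" using prob_eq_0[OF Z] by simp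
  then show ?thesis using AE_space by eventually_elim auto
qed

definition angle_limit :: "'a \<Rightarrow> real" where
  "angle_limit \<omega> = lim (\<lambda>n. angle (1 + real n) \<omega>)"

lemma angle_limit_measurable: "random_variable borel angle_limit"
  unfolding angle_limit_def[abs_def] by (intro borel_measurable_lim_metric angle_measurable) simp

text \<open>
  Each \<open>s\<close> gives its own description of the limit, through its own winding; by uniqueness of limits they
  all agree with \<open>angle_limit\<close>, which is built from \<open>s = 1\<close>.
\<close>

lemma AE_angle_limit:
  assumes s: "0 < s"
  shows "AE \<omega> in M. ((\<lambda>t. angle t \<omega>) \<longlongrightarrow> angle_limit \<omega>) at_top \<and>
    (\<forall>\<^sub>F t in at_top. angle_limit \<omega> - angle t \<omega> = winding_limit s \<omega> - \<Theta> s t \<omega>)"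
  using AE_winding_limit[OF s] angle_winding[OF s] AE_limit_angle_off_cut[OF s]
proof eventually_elim
  case (elim \<omega>)
  note angle_eq = elim(2)
  let ?l = "angle s \<omega> + winding_limit s \<omega>"
  have lim: "((\<lambda>t. angle s \<omega> + \<Theta> s t \<omega>) \<longlongrightarrow> ?l) at_top"
    using elim(1) by (intro tendsto_intros) auto
  have "\<forall>\<^sub>F t in at_top. (angle s \<omega> + \<Theta> s t \<omega>) rmod (2 * pi) - ?l rmod (2 * pi) = angle s \<omega> + \<Theta> s t \<omega> - ?l"
    by (rule rmod_locally_translation[OF _ lim elim(3)]) simp
  then have transl: "\<forall>\<^sub>F t in at_top. ?l rmod (2 * pi) - angle t \<omega> = winding_limit s \<omega> - \<Theta> s t \<omega>"
    using eventually_ge_at_top[of s]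
  proof eventually_elim
    case (elim t)
    then have "angle t \<omega> = (angle s \<omega> + \<Theta> s t \<omega>) rmod (2 * pi)"
      using angle_eq by blast
    then show ?case using elim(1) by linarith
  qed
  then have transl': "\<forall>\<^sub>F t in at_top. ?l rmod (2 * pi) - (winding_limit s \<omega> - \<Theta> s t \<omega>) = angle t \<omega>"
    by eventually_elim linarith
  have "((\<lambda>t. ?l rmod (2 * pi) - (winding_limit s \<omega> - \<Theta> s t \<omega>)) \<longlongrightarrow> ?l rmod (2 * pi) - (winding_limit s \<omega> - winding_limit s \<omega>)) at_top"
    using elim(1) by (intro tendsto_intros) auto
  then have conv: "((\<lambda>t. angle t \<omega>) \<longlongrightarrow> ?l rmod (2 * pi)) at_top"
    using Lim_transform_eventually[OF _ transl'] by simp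
  have "filterlim (\<lambda>n. 1 + real n) at_top sequentially"
    by (rule filterlim_tendsto_add_at_top[OF tendsto_const filterlim_real_sequentially])
  from filterlim_compose[OF conv this] have "angle_limit \<omega> = ?l rmod (2 * pi)"
    unfolding angle_limit_def by (rule limI)
  then show ?case using conv transl by simp
qed

lemma angle_limit_uniform: "uniform_angle angle_limit"
  unfolding uniform_angle_def
proof
  show "distr M borel angle_limit = uniform_measure lborel {0..<2 * pi}"
  proof (rule AE_limit_same_distribution)
    show "random_variable borel (angle (1 + real n))" for n by (rule angle_measurable) simp
    show "distr M borel (angle (1 + real n)) = uniform_measure lborel {0..<2 * pi}" for n
      by (rule angle_distribution) simp
    show "AE \<omega> in M. (\<lambda>n. angle (1 + real n) \<omega>) \<longlonglongrightarrow> angle_limit \<omega>"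
      using AE_angle_limit[OF zero_less_one]
    proof eventually_elim
      case (elim \<omega>)
      have "filterlim (\<lambda>n. 1 + real n) at_top sequentially"
        by (rule filterlim_tendsto_add_at_top[OF tendsto_const filterlim_real_sequentially])
      with conjunct1[OF elim] show ?case by (rule filterlim_compose)
    qed
  qed (rule angle_limit_measurable)
qed (rule angle_limit_measurable)

lemma AE_rates:
  assumes s: "0 < s"
  shows "AE \<omega> in M.
    Limsup at_top (\<lambda>t. ereal (1 / t) * eln \<bar>winding_limit s \<omega> - \<Theta> s t \<omega>\<bar>) = ereal (- 1 / 2) \<and>
    Limsup at_top (\<lambda>t. ereal (1 / t) * eln \<bar>angle_limit \<omega> - angle t \<omega>\<bar>) = ereal (- 1 / 2)"
  using AE_winding_limit[OF s] AE_angle_limit[OF s]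
proof eventually_elim
  case (elim \<omega>)
  have "Limsup at_top (\<lambda>t. ereal (1 / t) * eln \<bar>angle_limit \<omega> - angle t \<omega>\<bar>)
      = Limsup at_top (\<lambda>t. ereal (1 / t) * eln \<bar>winding_limit s \<omega> - \<Theta> s t \<omega>\<bar>)"
    using elim(2) by (intro Limsup_eq) (auto elim: eventually_mono)
  with elim(1) show ?case by simp
qed

end

theorem proposition1p1:
  fixes M :: "'a measure"
    and B :: "real \<Rightarrow> 'a \<Rightarrow> complex"
    and WR :: "real \<Rightarrow> 'a \<Rightarrow> real"
    and W \<Theta> :: "real \<Rightarrow> real \<Rightarrow> 'a \<Rightarrow> real"
  assumes "hyperbolic_brownian_motion M B WR W \<Theta>"
  shows "(AE \<omega> in M. (SUP t\<in>{0..}. ereal \<bar>polar_radius (B t \<omega>) - WR t \<omega> - t / 2\<bar>) < \<infinity>) \<and>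
    (AE \<omega> in M. ((\<lambda>t. polar_radius (B t \<omega>) / t) \<longlongrightarrow> 1 / 2) at_top) \<and>
    (\<forall>t\<ge>0. integrable M (\<lambda>\<omega>. polar_radius (B t \<omega>))) \<and>
    ((\<lambda>t. (\<integral>\<omega>. polar_radius (B t \<omega>) \<partial>M) / t) \<longlongrightarrow> 1 / 2) at_top \<and>
    (\<exists>\<theta>lim \<Theta>lim.
      prob_space.uniform_angle M \<theta>lim \<and>
      (AE \<omega> in M. ((\<lambda>t. polar_angle (B t \<omega>)) \<longlongrightarrow> \<theta>lim \<omega>) at_top) \<and>
      (\<forall>s>0.
        \<Theta>lim s \<in> borel_measurable M \<and>
        (AE \<omega> in M. ((\<lambda>t. \<Theta> s t \<omega>) \<longlongrightarrow> \<Theta>lim s \<omega>) at_top) \<and>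
        (AE \<omega> in M.
          Limsup at_top (\<lambda>t. ereal (1 / t) * eln \<bar>\<Theta>lim s \<omega> - \<Theta> s t \<omega>\<bar>) = ereal (- 1 / 2) \<and>
          Limsup at_top (\<lambda>t. ereal (1 / t) * eln \<bar>\<theta>lim \<omega> - polar_angle (B t \<omega>)\<bar>) = ereal (- 1 / 2))))"
proof -
  interpret hyperbolic_brownian_motion M B WR W \<Theta> by (rule assms)
  show ?thesis
  proof (intro conjI exI allI impI)
    show "AE \<omega> in M. (SUP t\<in>{0..}. ereal \<bar>R t \<omega> - WR t \<omega> - t / 2\<bar>) < \<infinity>"
      by (rule AE_deviation_bounded)
    show "AE \<omega> in M. ((\<lambda>t. R t \<omega> / t) \<longlongrightarrow> 1 / 2) at_top" by (rule AE_speed)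
    show "integrable M (R t)" if "0 \<le> t" for t using that by (rule R_integrable)
    show "((\<lambda>t. expectation (R t) / t) \<longlongrightarrow> 1 / 2) at_top" by (rule mean_speed)
    show "uniform_angle angle_limit" by (rule angle_limit_uniform)
    show "AE \<omega> in M. ((\<lambda>t. angle t \<omega>) \<longlongrightarrow> angle_limit \<omega>) at_top"
      using AE_angle_limit[OF zero_less_one] by eventually_elim simp
    fix s :: real assume s: "0 < s"
    show "winding_limit s \<in> borel_measurable M" by (rule winding_limit_measurable[OF s])
    show "AE \<omega> in M. ((\<lambda>t. \<Theta> s t \<omega>) \<longlongrightarrow> winding_limit s \<omega>) at_top"
      using AE_winding_limit[OF s] by eventually_elim simp
    show "AE \<omega> in M.
        Limsup at_top (\<lambda>t. ereal (1 / t) * eln \<bar>winding_limit s \<omega> - \<Theta> s t \<omega>\<bar>) = ereal (- 1 / 2) \<and>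
        Limsup at_top (\<lambda>t. ereal (1 / t) * eln \<bar>angle_limit \<omega> - angle t \<omega>\<bar>) = ereal (- 1 / 2)"
      by (rule AE_rates[OF s])
  qed
qed

end
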